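(* Let $(X;\mathbb A)$ be a CW $n$-ad where $X$ is countable. Let $(Y;\mathbb B)$ be an $n$-ad having the homotopy type of a CW $n$-ad and having finite homotopy groups. If the function space $(Y;\mathbb B)^{(X;\mathbb A)}$ has the homotopy type of a CW complex, then it has finitely many path components.
   Context: A CW $n$-ad $(X;\mathbb A)=(X;A_1,\dots,A_n)$ is a CW complex $X$ with subcomplexes $A_1,\dots,A_n$; $X$ is countable if it has countably many cells. $(Y;\mathbb B)=(Y;B_1,\dots,B_n)$ has the homotopy type of a CW $n$-ad if it is homotopy equivalent to one by maps and homotopies respecting the distinguished subsets. $(Y;\mathbb B)^{(X;\mathbb A)}$ is the subspace of $Y^X$ (compact open topology) of maps $f$ with $f(A_i)\subset B_i$ for all $i$. A space has finite homotopy groups if it has finitely many path components and each homotopy group of each path component is finite. The $n$-ad $(Y;\mathbb B)$ has finite homotopy groups if $Y$ and all possible intersections of the sets $B_i$ have finite homotopy groups. *)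

theory Defs
  imports "HOL-Analysis.Analysis"
begin

section \<open>CW complexes\<close>

text \<open>Discs live in the abstract topology \<open>Euclidean_space n\<close>, whose points are the functions
  of type \<open>nat \<Rightarrow> real\<close> that vanish from index \<open>n\<close> on. For \<open>n = 0\<close> the disc is a point and its
  boundary is empty.\<close>

definition closed_disc :: "nat \<Rightarrow> (nat \<Rightarrow> real) set" where
  "closed_disc n = {x \<in> topspace (Euclidean_space n). (\<Sum>i<n. (x i)\<^sup>2) \<le> 1}"

definition open_disc :: "nat \<Rightarrow> (nat \<Rightarrow> real) set" where
  "open_disc n = {x \<in> topspace (Euclidean_space n). (\<Sum>i<n. (x i)\<^sup>2) < 1}"

definition disc_boundary :: "nat \<Rightarrow> (nat \<Rightarrow> real) set" where
  "disc_boundary n = {x \<in> topspace (Euclidean_space n). (\<Sum>i<n. (x i)\<^sup>2) = 1}"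

text \<open>A CW structure on \<open>X\<close> is given by the set \<open>E\<close> of its open cells, \<open>d e\<close> being the dimension
  of the cell \<open>e\<close>. The boundary of a cell is attached to finitely many cells of smaller
  dimension.\<close>

definition characteristic_map ::
  "'a topology \<Rightarrow> 'a set set \<Rightarrow> ('a set \<Rightarrow> nat) \<Rightarrow> 'a set \<Rightarrow> ((nat \<Rightarrow> real) \<Rightarrow> 'a) \<Rightarrow> bool" where
  "characteristic_map X E d e \<phi> \<longleftrightarrow>
     continuous_map (subtopology (Euclidean_space (d e)) (closed_disc (d e))) X \<phi> \<and>
     homeomorphic_map (subtopology (Euclidean_space (d e)) (open_disc (d e))) (subtopology X e) \<phi> \<and>
     (\<exists>F \<subseteq> E. finite F \<and> (\<forall>c\<in>F. d c < d e) \<and> \<phi> ` disc_boundary (d e) \<subseteq> \<Union>F)"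

definition CW_complex :: "'a topology \<Rightarrow> 'a set set \<Rightarrow> bool" where
  "CW_complex X E \<longleftrightarrow>
     Hausdorff_space X \<and>
     disjoint E \<and> \<Union>E = topspace X \<and>
     (\<exists>d. \<forall>e\<in>E. \<exists>\<phi>. characteristic_map X E d e \<phi>) \<and>
     (\<forall>C \<subseteq> topspace X. (\<forall>e\<in>E. closedin X (C \<inter> X closure_of e)) \<longrightarrow> closedin X C)"

definition CW_subcomplex :: "'a topology \<Rightarrow> 'a set set \<Rightarrow> 'a set \<Rightarrow> bool" where
  "CW_subcomplex X E A \<longleftrightarrow> (\<exists>F \<subseteq> E. A = \<Union>F \<and> (\<forall>e\<in>F. X closure_of e \<subseteq> A))"


section \<open>\<open>n\<close>-ads\<close>

text \<open>The distinguished subsets of an \<open>n\<close>-ad are \<open>A 1, \<dots>, A n\<close>; other values of \<open>A\<close> are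
  irrelevant.\<close>

definition n_ad :: "nat \<Rightarrow> 'a topology \<Rightarrow> (nat \<Rightarrow> 'a set) \<Rightarrow> bool" where
  "n_ad n X A \<longleftrightarrow> (\<forall>i\<in>{1..n}. A i \<subseteq> topspace X)"

definition CW_n_ad :: "nat \<Rightarrow> 'a topology \<Rightarrow> 'a set set \<Rightarrow> (nat \<Rightarrow> 'a set) \<Rightarrow> bool" where
  "CW_n_ad n X E A \<longleftrightarrow> CW_complex X E \<and> (\<forall>i\<in>{1..n}. CW_subcomplex X E (A i))"

definition preserves_subsets :: "nat \<Rightarrow> (nat \<Rightarrow> 'a set) \<Rightarrow> (nat \<Rightarrow> 'b set) \<Rightarrow> ('a \<Rightarrow> 'b) \<Rightarrow> bool" where
  "preserves_subsets n A B f \<longleftrightarrow> (\<forall>i\<in>{1..n}. f ` A i \<subseteq> B i)"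

definition n_ad_homotopy_equivalent ::
  "nat \<Rightarrow> 'a topology \<Rightarrow> (nat \<Rightarrow> 'a set) \<Rightarrow> 'b topology \<Rightarrow> (nat \<Rightarrow> 'b set) \<Rightarrow> bool" where
  "n_ad_homotopy_equivalent n X A Y B \<longleftrightarrow>
     (\<exists>f g. continuous_map X Y f \<and> preserves_subsets n A B f \<and>
            continuous_map Y X g \<and> preserves_subsets n B A g \<and>
            homotopic_with (preserves_subsets n A A) X X (g \<circ> f) id \<and>
            homotopic_with (preserves_subsets n B B) Y Y (f \<circ> g) id)"


section \<open>Function spaces\<close>

text \<open>Continuous maps are represented by functions that are \<open>undefined\<close> off \<open>topspace X\<close>, so that
  distinct points of the function space are distinct maps.\<close>

definition maps :: "'a topology \<Rightarrow> 'b topology \<Rightarrow> ('a \<Rightarrow> 'b) set" where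
  "maps X Y = {f \<in> extensional (topspace X). continuous_map X Y f}"

definition compact_open_topology :: "'a topology \<Rightarrow> 'b topology \<Rightarrow> ('a \<Rightarrow> 'b) topology" where
  "compact_open_topology X Y =
     topology_generated_by {{f \<in> maps X Y. f ` K \<subseteq> U} | K U. compactin X K \<and> openin Y U}"

lemma topspace_compact_open_topology: "topspace (compact_open_topology X Y) = maps X Y"
proof -
  have "{f \<in> maps X Y. f ` {} \<subseteq> {}} \<in> {{f \<in> maps X Y. f ` K \<subseteq> U} | K U. compactin X K \<and> openin Y U}"
    by blast
  then show ?thesis
    unfolding compact_open_topology_def topology_generated_by_topspace by auto
qed

definition n_ad_function_space ::
  "nat \<Rightarrow> 'a topology \<Rightarrow> (nat \<Rightarrow> 'a set) \<Rightarrow> 'b topology \<Rightarrow> (nat \<Rightarrow> 'b set) \<Rightarrow> ('a \<Rightarrow> 'b) topology" where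
  "n_ad_function_space n X A Y B =
     subtopology (compact_open_topology X Y) {f. preserves_subsets n A B f}"


section \<open>Finite homotopy groups\<close>

text \<open>The underlying set of the \<open>k\<close>-th homotopy group (\<open>k \<ge> 1\<close>) of \<open>X\<close> at \<open>x\<close>: pointed homotopy
  classes of pointed maps from the \<open>k\<close>-sphere. Its group structure plays no role for finiteness.
  Functions that agree on the sphere are homotopic in the sense of \<open>homotopic_with\<close>, so their
  values off the sphere do not create additional classes.\<close>

definition sphere_basepoint :: "nat \<Rightarrow> real" where
  "sphere_basepoint = (\<lambda>i. if i = 0 then 1 else 0)"

definition homotopy_group :: "nat \<Rightarrow> 'a topology \<Rightarrow> 'a \<Rightarrow> ((nat \<Rightarrow> real) \<Rightarrow> 'a) set set" where
  "homotopy_group k X x =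
     {f. continuous_map (nsphere k) X f \<and> f sphere_basepoint = x} //
     {(f, g). homotopic_with (\<lambda>h. h sphere_basepoint = x) (nsphere k) X f g}"

definition finite_homotopy_groups :: "'a topology \<Rightarrow> bool" where
  "finite_homotopy_groups X \<longleftrightarrow>
     finite (path_components_of X) \<and>
     (\<forall>C \<in> path_components_of X. \<forall>x\<in>C. \<forall>k\<ge>1. finite (homotopy_group k (subtopology X C) x))"

text \<open>The empty index set yields \<open>Y\<close> itself, as \<open>subtopology Y UNIV = Y\<close>.\<close>

definition n_ad_finite_homotopy_groups :: "nat \<Rightarrow> 'a topology \<Rightarrow> (nat \<Rightarrow> 'a set) \<Rightarrow> bool" where
  "n_ad_finite_homotopy_groups n Y B \<longleftrightarrow>
     (\<forall>J \<subseteq> {1..n}. finite_homotopy_groups (subtopology Y (\<Inter>i\<in>J. B i)))"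

end

theory Submission
  imports Defs
begin

text \<open>Exhaust \<open>X\<close> by finite subcomplexes \<open>L\<^sub>0 \<subseteq> L\<^sub>1 \<subseteq> \<dots>\<close>. Since the homotopy groups are finite, there
  are only finitely many homotopy classes of maps of \<open>n\<close>-ads on each \<open>L\<^sub>m\<close>. If the function space had
  infinitely many path components, then the pigeonhole principle and the homotopy extension property
  would yield a map \<open>f\<close> such that, for every \<open>m\<close>, infinitely many path components contain a map
  that agrees with \<open>f\<close> on \<open>L\<^sub>m\<close>. Choosing such maps outside the component of \<open>f\<close> gives a sequence
  converging to \<open>f\<close>, because every compact subset of \<open>X\<close> lies in some \<open>L\<^sub>m\<close>. But path components
  are open in a space of the homotopy type of a CW complex.\<close>

section \<open>Discs\<close>

text \<open>Finiteness on a stage is obtained one cell at a time. Once the map on the earlier cells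
  is fixed, what remains is a disc map with prescribed boundary values into the intersection of
  those \<open>B i\<close> for which the cell lies in \<open>A i\<close>; this is where the
  finiteness of all intersections enters. Such disc maps are counted by gluing each of them to one
  fixed \<open>w\<close> along an equator. The assignment into the k-th homotopy group is injective
  on relative homotopy classes, and injectivity alone bounds their number.

  Homotopies over \<open>X\<close> are only asserted to be continuous on the product of the interval
  with each stage. A path in the function space asks for no more, since the compact-open topology
  tests compact sets only.

  The recursion has to keep infinitely many components in play, because each new stage splits the
  surviving ones into finitely many classes again.\<close>

abbreviation interval_space :: "real topology" where
  "interval_space \<equiv> top_of_set {0..1}"

abbreviation disc_space :: "nat \<Rightarrow> (nat \<Rightarrow> real) topology" where
  "disc_space k \<equiv> subtopology (Euclidean_space k) (closed_disc k)"

abbreviation radius :: "nat \<Rightarrow> (nat \<Rightarrow> real) \<Rightarrow> real" where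
  "radius k x \<equiv> L2_set x {..<k}"

section \<open>Radial scaling and the topology of the disc\<close>

lemma topspace_disc_space [simp]: "topspace (disc_space k) = closed_disc k"
  by (auto simp: closed_disc_def)

lemma closed_disc_iff: "x \<in> closed_disc k \<longleftrightarrow> (\<forall>i\<ge>k. x i = 0) \<and> radius k x \<le> 1"
  by (auto simp: closed_disc_def topspace_Euclidean_space L2_set_def)

lemma disc_boundary_iff: "x \<in> disc_boundary k \<longleftrightarrow> (\<forall>i\<ge>k. x i = 0) \<and> radius k x = 1"
  by (auto simp: disc_boundary_def topspace_Euclidean_space L2_set_def)

lemma closed_disc_eq: "closed_disc k = open_disc k \<union> disc_boundary k"
  by (auto simp: closed_disc_def open_disc_def disc_boundary_def)

lemma zero_in_open_disc: "(\<lambda>i. 0) \<in> open_disc k"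
  by (auto simp: open_disc_def topspace_Euclidean_space)

lemma zero_in_closed_disc: "(\<lambda>i. 0) \<in> closed_disc k"
  using zero_in_open_disc closed_disc_eq by blast

lemma radius_scale: "0 \<le> c \<Longrightarrow> radius k (\<lambda>i. c * x i) = c * radius k x"
  by (simp add: L2_set_right_distrib)

lemma continuous_map_disc_coordinate: "continuous_map (disc_space k) euclideanreal (\<lambda>x. x i)"
  unfolding Euclidean_space_def
  by (intro continuous_map_from_subtopology continuous_map_product_projection) auto

lemma continuous_map_radius: 
  assumes "continuous_map Z (disc_space k) f"
  shows "continuous_map Z euclideanreal (\<lambda>z. radius k (f z))"
proof -
  have "continuous_map (disc_space k) euclideanreal (\<lambda>x. radius k x)"
    unfolding L2_set_def
    by (intro continuous_map_sqrt continuous_intros continuous_map_disc_coordinate) auto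
  from continuous_map_compose[OF assms this] show ?thesis by (simp add: o_def)
qed

lemma continuous_map_into_disc:
  assumes "\<And>i. continuous_map Z euclideanreal (\<lambda>z. f z i)"
    and "\<And>z. z \<in> topspace Z \<Longrightarrow> f z \<in> closed_disc k"
  shows "continuous_map Z (disc_space k) f"
  using assms unfolding Euclidean_space_def continuous_map_in_subtopology continuous_map_componentwise_UNIV
  by (auto simp: closed_disc_iff)

lemma continuous_map_disc_scale:
  assumes "continuous_map Z euclideanreal c" and "continuous_map Z (disc_space k) f"
    and "\<And>z. z \<in> topspace Z \<Longrightarrow> 0 \<le> c z \<and> c z * radius k (f z) \<le> 1"
  shows "continuous_map Z (disc_space k) (\<lambda>z i. c z * f z i)"
proof (rule continuous_map_into_disc)
  show "continuous_map Z euclideanreal (\<lambda>z. c z * f z i)" for i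
    using continuous_map_compose[OF assms(2) continuous_map_disc_coordinate]
    by (intro continuous_intros assms) (auto simp: o_def)
  show "(\<lambda>i. c z * f z i) \<in> closed_disc k" if "z \<in> topspace Z" for z
    using assms(3)[OF that] assms(2) that
    by (auto simp: closed_disc_iff radius_scale continuous_map_def Pi_iff)
qed

text \<open>The disc is closed in the power of the real line and lies in the cube with sides
  [-1, 1], which is compact by Tychonoff.\<close>

lemma compact_disc_space: "compact_space (disc_space k)"
proof -
  let ?P = "powertop_real (UNIV :: nat set)"
  have "closedin ?P {x \<in> topspace ?P. (\<Sum>i<k. (x i)\<^sup>2) \<in> {..1}}"
    by (rule closedin_continuous_map_preimage) 
       (auto intro!: continuous_intros continuous_map_product_projection)
  then have "closedin ?P (topspace (Euclidean_space k) \<inter> {x. (\<Sum>i<k. (x i)\<^sup>2) \<le> 1})"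
    using closedin_Euclidean_space by (auto intro: closedin_Int)
  then have cl: "closedin ?P (closed_disc k)"
    by (simp add: closed_disc_def Collect_conj_eq)
  have "compactin ?P (PiE UNIV (\<lambda>i. {-1..1}))"
    by (simp add: compactin_PiE)
  moreover have "closed_disc k \<subseteq> PiE UNIV (\<lambda>i. {-1..1})"
  proof
    fix x assume x: "x \<in> closed_disc k"
    have "\<bar>x i\<bar> \<le> 1" for i
    proof (cases "i < k")
      case True
      then have "(x i)\<^sup>2 \<le> (\<Sum>i<k. (x i)\<^sup>2)"
        by (intro member_le_sum) auto
      also have "\<dots> \<le> 1" using x by (simp add: closed_disc_def)
      finally show ?thesis by (simp add: abs_square_le_1)
    qed (use x in \<open>auto simp: closed_disc_iff\<close>)
    then have "- 1 \<le> x i \<and> x i \<le> 1" for i by (meson abs_le_iff minus_le_iff)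
    then show "x \<in> PiE UNIV (\<lambda>i. {-1..1})" by auto
  qed
  ultimately have "compactin ?P (closed_disc k)"
    using cl closed_compactin by blast
  moreover have "{x. \<forall>i\<ge>k. x i = 0} \<inter> closed_disc k = closed_disc k"
    by (auto simp: closed_disc_iff)
  ultimately show ?thesis
    unfolding Euclidean_space_def subtopology_subtopology by (simp add: compact_space_subtopology)
qed

lemma path_connected_disc_space: "path_connected_space (disc_space k)"
proof -
  have "path_component_of (disc_space k) (\<lambda>i. 0) x" if x: "x \<in> closed_disc k" for x
    unfolding path_component_of_def pathin_def
  proof (intro exI conjI)
    show "continuous_map interval_space (disc_space k) (\<lambda>t i. t * x i)"
      using x by (intro continuous_map_disc_scale)
        (auto simp: closed_disc_iff mult_le_one topspace_Euclidean_space intro: continuous_map_from_subtopology)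
  qed auto
  then show ?thesis
    unfolding path_connected_space_iff_path_component 
    by (metis path_component_of_sym path_component_of_trans topspace_disc_space)
qed

text \<open>Linear interpolation of the scaling factors works because on the set \<open>p = 0\<close>, where the two
  branches meet, every interpolated factor moves \<open>x\<close> to the boundary.\<close>

lemma homotopic_piecewise_scale:
  fixes u w :: "(nat \<Rightarrow> real) \<Rightarrow> 'b"
  assumes u: "continuous_map (disc_space k) Y u" and w: "continuous_map (disc_space k) Y w"
    and uw: "\<And>x. x \<in> disc_boundary k \<Longrightarrow> u x = w x"
    and p: "continuous_map (disc_space k) euclideanreal p"
    and c: "continuous_map (disc_space k) euclideanreal c"
    and c': "continuous_map (disc_space k) euclideanreal c'"
    and bounds: "\<And>x. x \<in> closed_disc k \<Longrightarrow> 0 \<le> c x \<and> c x * radius k x \<le> 1 \<and> 0 \<le> c' x \<and> c' x * radius k x \<le> 1"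
    and threshold: "\<And>x. x \<in> closed_disc k \<Longrightarrow> p x = 0 \<Longrightarrow> c x * radius k x = 1 \<and> c' x * radius k x = 1"
    and boundary: "\<And>x. x \<in> disc_boundary k \<Longrightarrow> c x = 1 \<and> c' x = 1"
  shows "homotopic_with (\<lambda>f. \<forall>x\<in>disc_boundary k. f x = w x) (disc_space k) Y
           (\<lambda>x. if p x \<le> 0 then u (\<lambda>i. c x * x i) else w (\<lambda>i. c x * x i))
           (\<lambda>x. if p x \<le> 0 then u (\<lambda>i. c' x * x i) else w (\<lambda>i. c' x * x i))"
proof -
  let ?Z = "prod_topology interval_space (disc_space k)"
  define s where "s = (\<lambda>z. (1 - fst z) * c (snd z) + fst z * c' (snd z))"
  define m where "m = (\<lambda>z i. s z * snd z i)"
  have snd: "continuous_map ?Z (disc_space k) snd" 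
    by (rule continuous_map_snd)
  have fst: "continuous_map ?Z euclideanreal fst" 
    using continuous_map_fst continuous_map_into_fulltopology by blast
  have comp: "continuous_map ?Z euclideanreal (\<lambda>z. q (snd z))" 
    if "continuous_map (disc_space k) euclideanreal q" for q
    using continuous_map_compose[OF snd that] by (simp add: o_def)
  have cs: "continuous_map ?Z euclideanreal s"
    unfolding s_def by (intro continuous_intros fst comp c c')
  have sb: "0 \<le> s z \<and> s z * radius k (snd z) \<le> 1" if "z \<in> topspace ?Z" for z
  proof -
    obtain t x where "z = (t, x)" by (cases z)
    with that have z: "z = (t, x)" "0 \<le> t" "t \<le> 1" "x \<in> closed_disc k" by auto
    have "s z * radius k x = (1 - t) * (c x * radius k x) + t * (c' x * radius k x)"
      by (simp add: s_def z algebra_simps)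
    also have "\<dots> \<le> (1 - t) * 1 + t * 1"
      using bounds[OF z(4)] z by (intro add_mono mult_left_mono) auto
    finally show ?thesis using bounds[OF z(4)] z by (simp add: s_def)
  qed
  have cm: "continuous_map ?Z (disc_space k) m"
    unfolding m_def by (rule continuous_map_disc_scale[OF cs snd sb])
  have mb: "m z \<in> disc_boundary k" if z: "z \<in> topspace ?Z" "p (snd z) = 0" for z
  proof -
    obtain t x where zx: "z = (t, x)" "x \<in> closed_disc k" using z by auto
    have "s z * radius k x = (1 - t) * (c x * radius k x) + t * (c' x * radius k x)"
      by (simp add: s_def zx algebra_simps)
    also have "\<dots> = 1" using threshold[OF zx(2)] z zx by simp
    finally have "s z * radius k x = 1" .
    moreover have "radius k (m z) = s z * radius k (snd z)"
      unfolding m_def using sb[OF z(1)] by (simp add: radius_scale)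
    ultimately show ?thesis 
      using zx by (auto simp: disc_boundary_iff m_def closed_disc_iff)
  qed
  define h where "h = (\<lambda>z. if p (snd z) \<le> 0 then u (m z) else w (m z))"
  have "continuous_map ?Z Y h"
    unfolding h_def
  proof (rule continuous_map_cases_le)
    show "u (m z) = w (m z)" if "z \<in> topspace ?Z" "p (snd z) = 0" for z
      using mb[OF that] uw by blast
  qed (use continuous_map_compose[OF cm u] continuous_map_compose[OF cm w] in 
       \<open>auto simp: comp p o_def intro: continuous_map_from_subtopology\<close>)
  moreover have "h (t, x) = w x" if "x \<in> disc_boundary k" for t x
    using boundary[OF that] uw[OF that] by (auto simp: h_def m_def s_def)
  ultimately show ?thesis
    unfolding homotopic_with_def
    by (intro exI[of _ h]) (auto simp: h_def m_def s_def)
qed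

text \<open>Two maps of the disc that agree on its boundary, placed on the hemispheres \<open>y 0 \<le> 0\<close> and
  \<open>0 \<le> y 0\<close> of the sphere; the basepoint is the centre of the second one.\<close>

definition hemisphere_union :: "((nat \<Rightarrow> real) \<Rightarrow> 'b) \<Rightarrow> ((nat \<Rightarrow> real) \<Rightarrow> 'b) \<Rightarrow> (nat \<Rightarrow> real) \<Rightarrow> 'b" where
  "hemisphere_union u w y = (if y 0 \<le> 0 then u (\<lambda>i. y (Suc i)) else w (\<lambda>i. y (Suc i)))"

section \<open>Spheres glued from two discs\<close>

lemma nsphere_iff: 
  "y \<in> topspace (nsphere k) \<longleftrightarrow> (\<forall>i\<ge>k. y (Suc i) = 0) \<and> (y 0)\<^sup>2 + (radius k (\<lambda>i. y (Suc i)))\<^sup>2 = 1"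
proof -
  have "(\<Sum>i\<le>k. (y i)\<^sup>2) = (y 0)\<^sup>2 + (radius k (\<lambda>i. y (Suc i)))\<^sup>2"
    unfolding L2_set_def by (simp add: sum.atMost_shift sum_nonneg)
  moreover have "(\<forall>i\<ge>Suc k. y i = 0) \<longleftrightarrow> (\<forall>i\<ge>k. y (Suc i) = 0)"
    by (metis Suc_le_D Suc_le_mono)
  ultimately show ?thesis
    by (auto simp: nsphere_def topspace_Euclidean_space)
qed

lemma hemisphere_union_base: "hemisphere_union u w sphere_basepoint = w (\<lambda>i. 0)"
  by (simp add: hemisphere_union_def sphere_basepoint_def)

text \<open>The branches meet on the equator \<open>y 0 = 0\<close>, whose points project to unit
  vectors, that is, to the disc boundary where \<open>u\<close> and \<open>w\<close> agree.\<close>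

lemma continuous_map_hemisphere_union:
  assumes u: "continuous_map (disc_space k) Y u" and w: "continuous_map (disc_space k) Y w"
    and uw: "\<And>x. x \<in> disc_boundary k \<Longrightarrow> u x = w x"
  shows "continuous_map (nsphere k) Y (hemisphere_union u w)"
proof -
  have t: "continuous_map (nsphere k) (disc_space k) (\<lambda>y i. y (Suc i))"
  proof (rule continuous_map_into_disc)
    show "(\<lambda>i. z (Suc i)) \<in> closed_disc k" if "z \<in> topspace (nsphere k)" for z
    proof -
      have "(radius k (\<lambda>i. z (Suc i)))\<^sup>2 \<le> 1"
        using that nsphere_iff[of z k] zero_le_power2[of "z 0"] by linarith
      then show ?thesis
        using that nsphere_iff[of z k] by (simp add: closed_disc_iff abs_square_le_1)
    qed
  qed (rule continuous_map_nsphere_projection)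
  have "continuous_map (nsphere k) Y (\<lambda>y. if y 0 \<le> 0 then u (\<lambda>i. y (Suc i)) else w (\<lambda>i. y (Suc i)))"
  proof (rule continuous_map_cases_le)
    show "u (\<lambda>i. y (Suc i)) = w (\<lambda>i. y (Suc i))" if "y \<in> topspace (nsphere k)" "y 0 = 0" for y
      using that L2_set_nonneg[of "\<lambda>i. y (Suc i)" "{..<k}"]
      by (intro uw) (auto simp: nsphere_iff disc_boundary_iff power2_eq_1_iff)
  qed (use continuous_map_compose[OF t u] continuous_map_compose[OF t w] in 
      \<open>auto simp: o_def continuous_map_nsphere_projection intro: continuous_map_from_subtopology\<close>)
  then show ?thesis by (simp add: hemisphere_union_def[abs_def])
qed

text \<open>The map \<open>x \<mapsto> (2\<bar>x\<bar>\<^sup>2 - 1, 2 sqrt (1 - \<bar>x\<bar>\<^sup>2) x)\<close> collapses the boundary of the disc to the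
  basepoint of the sphere. Apply it to \<open>2x\<close> on the disc of radius \<open>1/2\<close>, follow it by
  \<open>hemisphere_union u w\<close>, and run along the radii from the centre of \<open>w\<close> back to the boundary on the
  remaining annulus. The result evaluates \<open>u\<close> or \<open>w\<close> at \<open>profile \<bar>x\<bar>\<close> times \<open>x\<close>. It is homotopic to
  \<open>u\<close> relative to the boundary, since the detour through \<open>w\<close> cancels.\<close>

definition profile :: "real \<Rightarrow> real" where
  "profile r = 4 * sqrt (max 0 (1 - 4 * r\<^sup>2)) + max 0 (2 * r - 1) / max r (1/2)"

text \<open>The factor 4 is 2 * 2: one 2 comes from the collapse map, the other from applying it to
  2x. The truncations by \<open>max\<close> in \<open>profile\<close> switch this summand off beyond
  radius 1/2 and the other one off below it, and the denominator \<open>max r (1/2)\<close> avoids a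
  division by zero, so one continuous formula covers both regions.\<close>

lemma profile_inner:
  assumes "0 \<le> r" "2 * r \<le> 1" shows "profile r = 4 * sqrt (1 - 4 * r\<^sup>2)" "4 * r\<^sup>2 \<le> 1"
proof -
  have "(2 * r)\<^sup>2 \<le> 1" using assms unfolding abs_square_le_1 by simp
  then show "4 * r\<^sup>2 \<le> 1" by (simp add: power_mult_distrib)
  then show "profile r = 4 * sqrt (1 - 4 * r\<^sup>2)" using assms by (simp add: profile_def)
qed

lemma profile_outer:
  assumes "1 \<le> 2 * r" shows "profile r = (2 * r - 1) / r" 
proof -
  have "1\<^sup>2 \<le> (2 * r)\<^sup>2" using assms by (intro power_mono) auto
  then have "4 * r\<^sup>2 \<ge> 1" by (simp add: power_mult_distrib)
  then show ?thesis using assms by (simp add: profile_def)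
qed

lemma profile_nonneg: "0 \<le> profile r"
  by (simp add: profile_def)

text \<open>In the inner half, \<open>8 * r\<^sup>2 - 1\<close> and \<open>profile r * r\<close> are
  the first coordinate of a point on the unit sphere and the norm of its other coordinates, so their
  squares add up to 1. On the annulus the product is \<open>2 * r - 1\<close>.\<close>

lemma profile_mult_le:
  assumes "0 \<le> r" "r \<le> 1" shows "profile r * r \<le> 1"
proof (cases "2 * r \<le> 1")
  case True
  note p = profile_inner[OF assms(1) True]
  have "(profile r * r)\<^sup>2 = 16 * (1 - 4 * r\<^sup>2) * r\<^sup>2"
    using p by (simp add: power_mult_distrib)
  also have "\<dots> = 1 - (8 * r\<^sup>2 - 1)\<^sup>2" by (simp add: power2_eq_square algebra_simps)
  also have "\<dots> \<le> 1" by simp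
  finally show ?thesis by (metis abs_le_iff abs_square_le_1)
qed (use assms in \<open>simp add: profile_outer\<close>)

text \<open>The zero of \<open>8 * r\<^sup>2 - 1\<close> is the radius at which the collapse reaches
  the equator and \<open>u\<close> gives way to \<open>w\<close>.\<close>

lemma profile_threshold:
  assumes "0 \<le> r" "8 * r\<^sup>2 = 1" shows "profile r * r = 1"
proof -
  have "(2 * r)\<^sup>2 \<le> 1\<^sup>2" using assms by (simp add: power_mult_distrib)
  then have "2 * r \<le> 1" by (rule power2_le_imp_le) simp
  note p = profile_inner[OF assms(1) this]
  have "(profile r * r)\<^sup>2 = 16 * (1 - 4 * r\<^sup>2) * r\<^sup>2"
    using p by (simp add: power_mult_distrib)
  also have "\<dots> = 1 - (8 * r\<^sup>2 - 1)\<^sup>2" by (simp add: power2_eq_square algebra_simps)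
  finally have "(profile r * r)\<^sup>2 = 1" using assms by simp
  then show ?thesis using assms profile_nonneg[of r]
    by (metis mult_nonneg_nonneg power2_eq_1_iff neg_0_le_iff_le not_one_le_zero)
qed

lemma continuous_map_profile:
  assumes "continuous_map Z euclideanreal f" 
  shows "continuous_map Z euclideanreal (\<lambda>z. profile (f z))"
  unfolding profile_def
  by (intro continuous_intros continuous_map_sqrt assms) auto

lemma homotopic_rel_profile:
  assumes u: "continuous_map (disc_space k) Y u" and w: "continuous_map (disc_space k) Y w"
    and uw: "\<And>x. x \<in> disc_boundary k \<Longrightarrow> u x = w x"
  shows "homotopic_with (\<lambda>f. \<forall>x\<in>disc_boundary k. f x = w x) (disc_space k) Y
           (\<lambda>x. if 8 * (radius k x)\<^sup>2 - 1 \<le> 0 then u (\<lambda>i. profile (radius k x) * x i) 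
                else w (\<lambda>i. profile (radius k x) * x i)) u"
proof -
  let ?P = "\<lambda>f. \<forall>x\<in>disc_boundary k. f x = w x"
  \<comment> \<open>This scaling stretches the disc of radius \<open>sqrt (1/8)\<close>, the zero of
    \<open>8 * r\<^sup>2 - 1\<close>, onto the whole disc and pushes everything outside it radially
    to the boundary.\<close>
  define c where "c = (\<lambda>x. 1 / max (radius k x) (sqrt (1/8)))"
  have rad: "continuous_map (disc_space k) euclideanreal (radius k)"
    using continuous_map_radius[of "disc_space k" k id] by simp
  have cc: "continuous_map (disc_space k) euclideanreal c"
    unfolding c_def by (intro continuous_intros rad) (auto simp: max_def)
  have c_nonneg: "0 \<le> c x" for x by (simp add: c_def le_max_iff_disj)
  have c_le: "c x * radius k x \<le> 1" for x
    by (auto simp: c_def divide_le_eq_1 max_def)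
  have c_outer: "c x * radius k x = 1" if "8 * (radius k x)\<^sup>2 \<ge> 1" for x
  proof -
    have "sqrt (1/8) \<le> radius k x"
      using that by (intro real_le_lsqrt) auto
    moreover have "0 < sqrt (1/8)" by simp
    ultimately have "0 < radius k x" "max (radius k x) (sqrt (1/8)) = radius k x" by linarith+
    then show ?thesis by (simp add: c_def)
  qed
  have bd: "profile (radius k x) = 1 \<and> c x = 1" if "x \<in> disc_boundary k" for x
    using that c_outer[of x] by (simp add: disc_boundary_iff profile_outer)
  have A: "homotopic_with ?P (disc_space k) Y
           (\<lambda>x. if 8 * (radius k x)\<^sup>2 - 1 \<le> 0 then u (\<lambda>i. profile (radius k x) * x i) 
                else w (\<lambda>i. profile (radius k x) * x i))
           (\<lambda>x. if 8 * (radius k x)\<^sup>2 - 1 \<le> 0 then u (\<lambda>i. c x * x i) else w (\<lambda>i. c x * x i))"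
    by (rule homotopic_piecewise_scale[OF u w uw _ _ cc])
       (auto simp: c_nonneg c_le c_outer bd profile_nonneg profile_mult_le closed_disc_iff profile_threshold
          intro!: continuous_intros rad continuous_map_profile)
  \<comment> \<open>With the constant -1 as \<open>p\<close> only the branch \<open>u\<close> is
    ever taken, so the stretching by \<open>c\<close> is undone inside \<open>u\<close>
    alone.\<close>
  have B: "homotopic_with ?P (disc_space k) Y
           (\<lambda>x. if (-1::real) \<le> 0 then u (\<lambda>i. c x * x i) else w (\<lambda>i. c x * x i))
           (\<lambda>x. if (-1::real) \<le> 0 then u (\<lambda>i. 1 * x i) else w (\<lambda>i. 1 * x i))"
    by (rule homotopic_piecewise_scale[OF u w uw _ cc])
       (auto simp: c_nonneg c_le bd closed_disc_iff)
  \<comment> \<open>Beyond the threshold the scaled point lies on the boundary, so the branch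
    \<open>w\<close> may be replaced by \<open>u\<close>.\<close>
  have eq: "w (\<lambda>i. c x * x i) = u (\<lambda>i. c x * x i)" if "x \<in> closed_disc k" "8 * (radius k x)\<^sup>2 - 1 > 0" for x
  proof -
    have "(\<lambda>i. c x * x i) \<in> disc_boundary k"
      using that c_outer[of x] c_nonneg[of x] by (simp add: disc_boundary_iff closed_disc_iff radius_scale)
    then show ?thesis by (simp add: uw)
  qed
  have "homotopic_with ?P (disc_space k) Y
           (\<lambda>x. if 8 * (radius k x)\<^sup>2 - 1 \<le> 0 then u (\<lambda>i. c x * x i) else w (\<lambda>i. c x * x i))
           (\<lambda>x. u (\<lambda>i. c x * x i))"
    using homotopic_with_imp_continuous_maps[OF A] homotopic_with_imp_property[OF A] 
      homotopic_with_imp_property[OF B] eq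
    by (intro homotopic_with_equal) auto
  moreover have "homotopic_with ?P (disc_space k) Y (\<lambda>x. u (\<lambda>i. c x * x i)) u"
    using B by simp
  ultimately show ?thesis
    using A homotopic_with_trans by blast
qed

text \<open>The pointed homotopy \<open>G\<close> is composed with the collapse of the inner half
  disc onto the sphere, and the annulus is filled with the stationary rays of \<open>w\<close>. This
  joins the detoured versions of \<open>u\<close> and \<open>v\<close>, each of which is homotopic
  to the original by \<open>homotopic_rel_profile\<close>.\<close>

lemma homotopic_rel_if_hemisphere_union_homotopic:
  assumes u: "continuous_map (disc_space k) Y u" and v: "continuous_map (disc_space k) Y v"
    and w: "continuous_map (disc_space k) Y w"
    and uw: "\<And>x. x \<in> disc_boundary k \<Longrightarrow> u x = w x"
    and vw: "\<And>x. x \<in> disc_boundary k \<Longrightarrow> v x = w x"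
    and hom: "homotopic_with (\<lambda>h. h sphere_basepoint = w (\<lambda>i. 0)) (nsphere k) Y 
                (hemisphere_union u w) (hemisphere_union v w)"
  shows "homotopic_with (\<lambda>f. \<forall>x\<in>disc_boundary k. f x = w x) (disc_space k) Y u v"
proof -
  let ?P = "\<lambda>f. \<forall>x\<in>disc_boundary k. f x = w x"
  let ?Z = "prod_topology interval_space (disc_space k)"
  let ?F = "\<lambda>u x. if 8 * (radius k x)\<^sup>2 - 1 \<le> 0 then u (\<lambda>i. profile (radius k x) * x i) 
                else w (\<lambda>i. profile (radius k x) * x i)"
  obtain G where G: "continuous_map (prod_topology interval_space (nsphere k)) Y G"
    and G0: "\<And>y. G (0, y) = hemisphere_union u w y" and G1: "\<And>y. G (1, y) = hemisphere_union v w y"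
    and Gb: "\<And>t. t \<in> {0..1} \<Longrightarrow> G (t, sphere_basepoint) = w (\<lambda>i. 0)"
    using hom unfolding homotopic_with_def by auto
  \<comment> \<open>This is the collapse map at 2x: coordinate 0 is 2|2x|^2 - 1, and the remaining
    coordinates are those of the scaled point.\<close>
  define q where "q = (\<lambda>x i. case i of 0 \<Rightarrow> 8 * (radius k x)\<^sup>2 - 1 | Suc j \<Rightarrow> profile (radius k x) * x j)"
  let ?D = "subtopology ?Z {z \<in> topspace ?Z. 2 * radius k (snd z) \<le> 1}"
  have snd: "continuous_map ?Z (disc_space k) snd" 
    by (rule continuous_map_snd)
  have rad: "continuous_map ?Z euclideanreal (\<lambda>z. radius k (snd z))"
    by (intro continuous_map_radius snd)
  have coord: "continuous_map ?Z euclideanreal (\<lambda>z. snd z j)" for j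
    using continuous_map_compose[OF snd continuous_map_disc_coordinate] by (simp add: o_def)
  have m: "continuous_map ?Z (disc_space k) (\<lambda>z i. profile (radius k (snd z)) * snd z i)"
    by (rule continuous_map_disc_scale)
       (auto simp: profile_nonneg profile_mult_le closed_disc_iff intro: continuous_map_profile rad snd)
  have q: "continuous_map ?D (nsphere k) (\<lambda>z. q (snd z))"
    unfolding nsphere continuous_map_in_subtopology continuous_map_componentwise_UNIV
  proof (intro conjI allI)
    show "continuous_map ?D euclideanreal (\<lambda>z. q (snd z) i)" for i
      unfolding q_def
      by (intro continuous_map_from_subtopology)
         (cases i; auto intro!: continuous_intros continuous_map_profile rad coord)
    have "q x \<in> topspace (nsphere k)" if "x \<in> closed_disc k" "2 * radius k x \<le> 1" for x
    proof -
      let ?r = "radius k x"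
      note p = profile_inner[OF _ that(2)]
      have "(profile ?r * ?r)\<^sup>2 = 16 * (1 - 4 * ?r\<^sup>2) * ?r\<^sup>2"
        using p by (simp add: power_mult_distrib)
      also have "\<dots> = 1 - (8 * ?r\<^sup>2 - 1)\<^sup>2" by (simp add: power2_eq_square algebra_simps)
      finally show ?thesis
        using that unfolding nsphere_iff by (simp add: q_def radius_scale profile_nonneg closed_disc_iff)
    qed
    then show "(\<lambda>z. q (snd z)) \<in> topspace ?D \<rightarrow> {x. (\<Sum>i\<le>k. (x i)\<^sup>2) = 1 \<and> (\<forall>i>k. x i = 0)}"
      by (auto simp: nsphere)
  qed
  define h where "h = (\<lambda>z. if 2 * radius k (snd z) \<le> 1 then G (fst z, q (snd z)) 
                            else w (\<lambda>i. profile (radius k (snd z)) * snd z i))"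
  have "continuous_map ?Z Y h"
    unfolding h_def
  proof (rule continuous_map_cases_le)
    show "continuous_map ?Z euclideanreal (\<lambda>z. 2 * radius k (snd z))"
      by (intro continuous_intros rad)
    have "continuous_map ?D (prod_topology interval_space (nsphere k)) (\<lambda>z. (fst z, q (snd z)))"
      unfolding continuous_map_pairwise using q
      by (auto simp: o_def intro: continuous_map_from_subtopology continuous_map_fst)
    from continuous_map_compose[OF this G] 
    show "continuous_map ?D Y (\<lambda>z. G (fst z, q (snd z)))" by (simp add: o_def)
    show "continuous_map (subtopology ?Z {z \<in> topspace ?Z. 1 \<le> 2 * radius k (snd z)}) Y 
            (\<lambda>z. w (\<lambda>i. profile (radius k (snd z)) * snd z i))"
      using continuous_map_compose[OF m w] by (intro continuous_map_from_subtopology) (simp add: o_def)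
    show "G (fst z, q (snd z)) = w (\<lambda>i. profile (radius k (snd z)) * snd z i)"
      if z: "z \<in> topspace ?Z" "2 * radius k (snd z) = 1" for z
    proof -
      have r: "radius k (snd z) = 1/2" using z by simp
      \<comment> \<open>At radius 1/2 the collapse reaches the basepoint and the outer ray starts at
        the centre. Both branches give \<open>w (\<lambda>i. 0)\<close> because \<open>G\<close>
        keeps the basepoint fixed.\<close>
      have "profile (1/2) = 0" by (simp add: profile_outer)
      moreover from this have "q (snd z) = sphere_basepoint"
        by (auto simp: q_def r sphere_basepoint_def fun_eq_iff power2_eq_square split: nat.split)
      ultimately show ?thesis using z Gb[of "fst z"] unfolding r by (cases z) auto
    qed
  qed simp
  moreover have "h (0, x) = ?F u x" "h (1, x) = ?F v x" for x
  proof -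
    let ?r = "radius k x"
    \<comment> \<open>\<open>h\<close> changes its formula at radius 1/2 but \<open>?F\<close> at
      the smaller radius \<open>sqrt (1/8)\<close>. They match at both ends because beyond radius
      1/2 the sign is positive and only \<open>w\<close> is evaluated.\<close>
    have "\<not> 8 * ?r\<^sup>2 - 1 \<le> 0" if "\<not> 2 * ?r \<le> 1"
    proof -
      have "1\<^sup>2 \<le> (2 * ?r)\<^sup>2" using that by (intro power_mono) auto
      then show ?thesis by (simp add: power_mult_distrib)
    qed
    then show "h (0, x) = ?F u x" "h (1, x) = ?F v x"
      by (auto simp: h_def G0 G1 hemisphere_union_def q_def)
  qed
  moreover have "h (t, x) = w x" if "x \<in> disc_boundary k" for t x
    using that by (simp add: h_def disc_boundary_iff profile_outer)
  ultimately have "homotopic_with ?P (disc_space k) Y (?F u) (?F v)"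
    unfolding homotopic_with_def by (intro exI[of _ h]) auto
  moreover have "homotopic_with ?P (disc_space k) Y u (?F u)"
    using homotopic_rel_profile[OF u w uw] by (simp add: homotopic_with_sym)
  moreover have "homotopic_with ?P (disc_space k) Y (?F v) v"
    using homotopic_rel_profile[OF v w vw] .
  ultimately show ?thesis
    using homotopic_with_trans by blast
qed

section \<open>Counting disc maps with fixed boundary values\<close>

lemma sphere_basepoint_in_disc_boundary: "1 \<le> k \<Longrightarrow> sphere_basepoint \<in> disc_boundary k"
  by (auto simp: disc_boundary_def topspace_Euclidean_space sphere_basepoint_def if_distrib[of "\<lambda>x. x\<^sup>2"] cong: if_cong)

lemma finite_image_representatives:
  assumes "finite (c ` S)" and "\<And>u v. u \<in> S \<Longrightarrow> v \<in> S \<Longrightarrow> c u = c v \<Longrightarrow> R u v"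
  shows "\<exists>V\<subseteq>S. finite V \<and> (\<forall>u\<in>S. \<exists>v\<in>V. R u v)"
proof -
  obtain V where V: "V \<subseteq> S" "finite V" "c ` S = c ` V"
    using finite_subset_image[OF assms(1) subset_refl] by blast
  have "\<exists>v\<in>V. R u v" if "u \<in> S" for u
  proof -
    have "c u \<in> c ` V" using V(3) that by blast
    then obtain v where "v \<in> V" "c u = c v" by blast
    then show ?thesis using assms(2) V(1) that by blast
  qed
  then show ?thesis using V by blast
qed

lemma disc_map_in_topspace:
  "continuous_map (disc_space k) Y u \<Longrightarrow> x \<in> closed_disc k \<Longrightarrow> u x \<in> topspace Y"
  unfolding continuous_map_def topspace_disc_space by blast

lemma homotopic_with_into_fulltopology:
  "homotopic_with P X (subtopology Y S) f g \<Longrightarrow> homotopic_with P X Y f g"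
  unfolding homotopic_with_def by (meson continuous_map_into_fulltopology)

text \<open>With one member \<open>w\<close> of \<open>S\<close> fixed, gluing sends every
  \<open>u\<close> to an element of the k-th homotopy group at the centre value of \<open>w\<close>,
  and equal elements force a relative homotopy. So there are at most as many classes as group
  elements. In dimension 0 the disc is a point with empty boundary, and path components do the
  counting.\<close>

lemma finite_disc_map_classes:
  fixes Y :: "'b topology" and k :: nat and b :: "(nat \<Rightarrow> real) \<Rightarrow> 'b"
  assumes fin: "finite_homotopy_groups Y"
  defines "S \<equiv> {u. continuous_map (disc_space k) Y u \<and> (\<forall>x\<in>disc_boundary k. u x = b x)}"
  shows "\<exists>U. finite U \<and> (\<forall>u\<in>S. \<exists>v\<in>U. homotopic_with (\<lambda>f. \<forall>x\<in>disc_boundary k. f x = b x) (disc_space k) Y u v)"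
proof -
  let ?P = "\<lambda>f. \<forall>x\<in>disc_boundary k. f x = b x"
  let ?G = "\<exists>V\<subseteq>S. finite V \<and> (\<forall>u\<in>S. \<exists>v\<in>V. homotopic_with ?P (disc_space k) Y u v)"
  have pos: "\<exists>c :: _ \<Rightarrow> ((nat \<Rightarrow> real) \<Rightarrow> 'b) set. finite (c ` S) \<and> 
          (\<forall>u\<in>S. \<forall>v\<in>S. c u = c v \<longrightarrow> homotopic_with ?P (disc_space k) Y u v)" if "S \<noteq> {}" "1 \<le> k"
  proof -
    obtain w where w: "w \<in> S" using \<open>S \<noteq> {}\<close> by blast
    define y where "y = w (\<lambda>i. 0)"
    \<comment> \<open>Homotopy groups are taken in single path components, so all maps must be
      confined to one. For k >= 1 the boundary is nonempty, and the values prescribed there put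
      every member of \<open>S\<close> into the component of \<open>w\<close>.\<close>
    define C where "C = path_component_of_set Y y"
    let ?Y = "subtopology Y C"
    have into: "continuous_map (disc_space k) ?Y u" if u: "u \<in> S" for u
    proof -
      have pc: "path_component_of Y (v x) (v x')" if "v \<in> S" "x \<in> closed_disc k" "x' \<in> closed_disc k" for v x x'
        using that path_component_of_continuous_image[of "disc_space k" Y v x x'] path_connected_disc_space[of k]
        by (auto simp: S_def path_connected_space_iff_path_component simp del: topspace_subtopology)
      have bp: "sphere_basepoint \<in> closed_disc k" "u sphere_basepoint = w sphere_basepoint"
        using sphere_basepoint_in_disc_boundary[OF \<open>1 \<le> k\<close>] u w by (auto simp: closed_disc_eq S_def)
      have "u x \<in> C" if "x \<in> closed_disc k" for x
        using pc[OF u bp(1) that] pc[OF w zero_in_closed_disc bp(1)] bp(2) path_component_of_trans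
        by (fastforce simp: C_def y_def)
      then show ?thesis
        using u by (auto simp: S_def continuous_map_in_subtopology)
    qed
    have "y \<in> topspace Y" 
      using w zero_in_closed_disc[of k] disc_map_in_topspace by (auto simp: y_def S_def)
    then have "C \<in> path_components_of Y" "y \<in> C"
      by (auto simp: C_def path_components_of_def path_component_of_refl)
    with fin \<open>1 \<le> k\<close> have fin: "finite (homotopy_group k ?Y y)"
      by (auto simp: finite_homotopy_groups_def)
    let ?H = "homotopic_with (\<lambda>h. h sphere_basepoint = y) (nsphere k) ?Y"
    define c where "c = (\<lambda>u. {(f, g). ?H f g} `` {hemisphere_union u w})"
    have hu: "continuous_map (nsphere k) ?Y (hemisphere_union u w)" "hemisphere_union u w sphere_basepoint = y"
      if "u \<in> S" for u
      using that w by (auto simp: S_def hemisphere_union_base y_def[symmetric] 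
          intro!: continuous_map_hemisphere_union into)
    have "c ` S \<subseteq> homotopy_group k ?Y y"
      using hu unfolding homotopy_group_def c_def quotient_def by blast
    then have "finite (c ` S)" using fin finite_subset by blast
    moreover have "homotopic_with ?P (disc_space k) Y u v" if "u \<in> S" "v \<in> S" "c u = c v" for u v
    proof -
      have "hemisphere_union v w \<in> c v"
        using hu[OF \<open>v \<in> S\<close>] by (simp add: c_def)
      then have "hemisphere_union v w \<in> c u" using that(3) by simp
      then have "?H (hemisphere_union u w) (hemisphere_union v w)" by (simp add: c_def)
      then have "homotopic_with (\<lambda>f. \<forall>x\<in>disc_boundary k. f x = w x) (disc_space k) ?Y u v"
        using that w into
        by (intro homotopic_rel_if_hemisphere_union_homotopic) (auto simp: S_def y_def)
      then have "homotopic_with ?P (disc_space k) ?Y u v"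
        by (rule homotopic_with_mono) (use w in \<open>auto simp: S_def\<close>)
      then show ?thesis by (rule homotopic_with_into_fulltopology)
    qed
    ultimately show ?thesis by (intro exI[of _ c] conjI ballI impI)
  qed
  have zero: "\<exists>c :: _ \<Rightarrow> 'b set. finite (c ` S) \<and> 
          (\<forall>u\<in>S. \<forall>v\<in>S. c u = c v \<longrightarrow> homotopic_with ?P (disc_space k) Y u v)" if "k = 0"
  proof (intro exI conjI ballI impI)
    define origin where "origin = (\<lambda>i::nat. 0::real)"
    have disc0: "closed_disc k = {origin}" and bd0: "disc_boundary k = {}"
      by (auto simp: closed_disc_iff disc_boundary_iff that fun_eq_iff origin_def)
    have "u origin \<in> topspace Y" if "u \<in> S" for u
      using that disc_map_in_topspace[of k Y u origin] unfolding S_def by (simp add: disc0)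
    then show "finite ((\<lambda>u. path_component_of_set Y (u origin)) ` S)"
      using fin by (auto simp: finite_homotopy_groups_def path_components_of_def intro: finite_subset[rotated])
    fix u v assume uv: "u \<in> S" "v \<in> S" "path_component_of_set Y (u origin) = path_component_of_set Y (v origin)"
    then have "path_component_of Y (u origin) (v origin)"
      by (metis (no_types, lifting) \<open>\<And>u. u \<in> S \<Longrightarrow> u origin \<in> topspace Y\<close> mem_Collect_eq path_component_of_refl)
    then obtain g where g: "pathin Y g" "g 0 = u origin" "g 1 = v origin" 
      by (auto simp: path_component_of_def)
    have "continuous_map (prod_topology interval_space (disc_space k)) Y (g \<circ> fst)"
      using g(1) unfolding pathin_def by (metis continuous_map_fst continuous_map_compose)
    then show "homotopic_with ?P (disc_space k) Y u v"
      using g disc0 bd0 by (subst homotopic_with) (auto intro!: exI[of _ "g \<circ> fst"])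
  qed
  have ?G
  proof (cases "k = 0")
    case True
    from zero[OF this] obtain c :: "_ \<Rightarrow> 'b set" where "finite (c ` S)"
      "\<forall>u\<in>S. \<forall>v\<in>S. c u = c v \<longrightarrow> homotopic_with ?P (disc_space k) Y u v" by blast
    then show ?thesis by (intro finite_image_representatives[of c]) blast+
  next
    case k: False
    show ?thesis
    proof (cases "S = {}")
      case False
      have "1 \<le> k" using k by simp
      from pos[OF False this] obtain c :: "_ \<Rightarrow> ((nat \<Rightarrow> real) \<Rightarrow> 'b) set" where "finite (c ` S)"
        "\<forall>u\<in>S. \<forall>v\<in>S. c u = c v \<longrightarrow> homotopic_with ?P (disc_space k) Y u v" by blast
      then show ?thesis by (intro finite_image_representatives[of c]) blast+
    qed auto
  qed
  then show ?thesis by blast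
qed

section \<open>Attaching a cell\<close>

lemma compact_interval_space: "compact_space interval_space"
  by (simp add: compact_space_subtopology)

lemma Hausdorff_interval_space: "Hausdorff_space interval_space"
  by (simp add: Hausdorff_space_subtopology)

text \<open>The preimage of a closed set splits into a part over \<open>S\<close>, closed because
  \<open>S\<close> is, and the image of a closed subset of the compact product of interval and disc,
  closed because the ambient product is Hausdorff.\<close>

lemma homotopy_extends_over_attached_cell:
  assumes X: "Hausdorff_space X" and S: "closedin X S" and \<phi>: "continuous_map (disc_space k) X \<phi>"
    and h: "continuous_map (prod_topology interval_space (subtopology X S)) Y h"
    and g: "continuous_map (prod_topology interval_space (disc_space k)) Y g"
    and compat: "\<And>t x. t \<in> {0..1} \<Longrightarrow> x \<in> closed_disc k \<Longrightarrow> \<phi> x \<in> S \<Longrightarrow> g (t, x) = h (t, \<phi> x)"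
    and inj: "\<And>x x'. x \<in> closed_disc k \<Longrightarrow> x' \<in> closed_disc k \<Longrightarrow> \<phi> x \<notin> S \<Longrightarrow> \<phi> x = \<phi> x' \<Longrightarrow> x = x'"
  obtains H where "continuous_map (prod_topology interval_space (subtopology X (S \<union> \<phi> ` closed_disc k))) Y H"
    "\<And>t y. t \<in> {0..1} \<Longrightarrow> y \<in> S \<Longrightarrow> H (t, y) = h (t, y)"
    "\<And>t x. t \<in> {0..1} \<Longrightarrow> x \<in> closed_disc k \<Longrightarrow> H (t, \<phi> x) = g (t, x)"
proof -
  let ?D = "closed_disc k" and ?I = "{0..1::real}"
  let ?ID = "prod_topology interval_space (disc_space k)"
  let ?IX = "prod_topology interval_space X"
  let ?IS = "prod_topology interval_space (subtopology X S)"
  let ?IT = "prod_topology interval_space (subtopology X (S \<union> \<phi> ` ?D))"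
  \<comment> \<open>Off \<open>S\<close> the preimage under \<phi> is unique, so
    \<open>inv_into\<close> recovers it; over \<open>S\<close> the two prescriptions agree by
    \<open>compat\<close>.\<close>
  define H where "H = (\<lambda>(t, y). if y \<in> S then h (t, y) else g (t, inv_into ?D \<phi> y))"
  have sub: "S \<subseteq> topspace X" "\<phi> ` ?D \<subseteq> topspace X"
    using closedin_subset[OF S] disc_map_in_topspace[OF \<phi>] by auto
  have Hg: "H (t, \<phi> x) = g (t, x)" if "t \<in> ?I" "x \<in> ?D" for t x
  proof (cases "\<phi> x \<in> S")
    case False
    have "inv_into ?D \<phi> (\<phi> x) = x"
      using that False by (metis inj f_inv_into_f image_eqI inv_into_into)
    with False show ?thesis by (simp add: H_def)
  qed (use that compat in \<open>simp add: H_def\<close>)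
  have Hh: "H (t, y) = h (t, y)" if "y \<in> S" for t y
    using that by (simp add: H_def)
  have top: "topspace ?IS = ?I \<times> S" "topspace ?ID = ?I \<times> ?D" "topspace ?IT = ?I \<times> (S \<union> \<phi> ` ?D)" 
    using sub by (auto simp del: topspace_subtopology simp: topspace_subtopology_subset)
  have "continuous_map ?IT Y H"
    unfolding continuous_map_closedin
  proof (intro conjI Pi_I allI impI)
    fix z assume "z \<in> topspace ?IT"
    then obtain t y where z: "z = (t, y)" "t \<in> ?I" "y \<in> S \<or> (\<exists>x\<in>?D. y = \<phi> x)"
      unfolding top by blast
    then show "H z \<in> topspace Y"
      using h g Hh Hg unfolding continuous_map_closedin top by fastforce
  next
    fix T assume T: "closedin Y T"
    let ?A = "{z \<in> topspace ?IS. h z \<in> T}" and ?B = "{z \<in> topspace ?ID. g z \<in> T}"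
    let ?j = "\<lambda>z. (fst z, \<phi> (snd z))"
    have "closedin ?IS ?A"
      using h T by (simp add: continuous_map_closedin)
    moreover have "closedin ?IX (topspace interval_space \<times> S)" 
      using S closedin_topspace by (auto simp: closedin_prod_Times_iff simp del: topspace_euclidean_subtopology)
    ultimately have A: "closedin ?IX ?A"
      unfolding prod_topology_subtopology(2) by (rule closedin_trans_full)
    have "closedin ?ID ?B"
      using g T by (simp add: continuous_map_closedin)
    moreover have "compact_space ?ID"
      by (simp add: compact_space_prod_topology compact_interval_space compact_disc_space)
    ultimately have "compactin ?ID ?B"
      by (rule closedin_compact_space[rotated])
    moreover have "continuous_map ?ID ?IX ?j"
      using continuous_map_compose[OF continuous_map_snd \<phi>]
      by (auto simp: continuous_map_pairwise o_def continuous_map_fst)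
    ultimately have "compactin ?IX (?j ` ?B)"
      by (rule image_compactin)
    then have B: "closedin ?IX (?j ` ?B)"
      using X Hausdorff_interval_space by (simp add: Hausdorff_space_prod_topology compactin_imp_closedin)
    have "{z \<in> topspace ?IT. H z \<in> T} = ?A \<union> ?j ` ?B"
    proof
      show "{z \<in> topspace ?IT. H z \<in> T} \<subseteq> ?A \<union> ?j ` ?B"
      proof
        fix z assume "z \<in> {z \<in> topspace ?IT. H z \<in> T}"
        then obtain t y where z: "z = (t, y)" "t \<in> ?I" "y \<in> S \<or> (\<exists>x\<in>?D. y = \<phi> x)" "H (t, y) \<in> T"
          unfolding top by blast
        show "z \<in> ?A \<union> ?j ` ?B"
        proof (cases "y \<in> S")
          case True
          then have "z \<in> ?A" unfolding top using z Hh by simp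
          then show ?thesis by blast
        next
          case False
          then obtain x where "x \<in> ?D" "y = \<phi> x" using z by blast
          then have "(t, x) \<in> ?B" "z = ?j (t, x)" using z Hg by (auto simp only: top mem_Sigma_iff mem_Collect_eq fst_conv snd_conv)
          then show ?thesis by blast
        qed
      qed
      show "?A \<union> ?j ` ?B \<subseteq> {z \<in> topspace ?IT. H z \<in> T}"
        unfolding top using Hh Hg by auto
    qed
    then have "closedin ?IX {z \<in> topspace ?IT. H z \<in> T}"
      using A B by (simp only: closedin_Un)
    then show "closedin ?IT {z \<in> topspace ?IT. H z \<in> T}"
      unfolding prod_topology_subtopology(2) by (rule closedin_subset_topspace) auto
  qed
  then show ?thesis using that Hg Hh by blast
qed

section \<open>Cell structures\<close>

locale cell_structure =
  fixes X :: "'a topology" and E :: "'a set set" and d :: "'a set \<Rightarrow> nat" 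
    and \<phi> :: "'a set \<Rightarrow> (nat \<Rightarrow> real) \<Rightarrow> 'a"
  assumes Hausdorff: "Hausdorff_space X"
    and disjoint_cells: "disjoint E" and Union_cells: "\<Union>E = topspace X"
    and characteristic: "\<And>e. e \<in> E \<Longrightarrow> characteristic_map X E d e (\<phi> e)"
    and weak_topology: "\<And>C. C \<subseteq> topspace X \<Longrightarrow> (\<And>e. e \<in> E \<Longrightarrow> closedin X (C \<inter> X closure_of e)) \<Longrightarrow> closedin X C"
begin

text \<open>A condition on attaching maps takes the place of the closures in
  \<open>CW_subcomplex\<close>: adding a cell only requires its boundary to be present, and
  closedness of the union follows from compactness.\<close>

definition finite_subcomplex :: "'a set set \<Rightarrow> bool" where
  "finite_subcomplex F \<longleftrightarrow> F \<subseteq> E \<and> finite F \<and> (\<forall>e\<in>F. \<phi> e ` disc_boundary (d e) \<subseteq> \<Union>F)"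

lemma continuous_characteristic: "e \<in> E \<Longrightarrow> continuous_map (disc_space (d e)) X (\<phi> e)"
  using characteristic by (simp add: characteristic_map_def)

lemma open_cell:
  assumes "e \<in> E" shows "\<phi> e ` open_disc (d e) = e" "inj_on (\<phi> e) (open_disc (d e))"
proof -
  have h: "homeomorphic_map (subtopology (Euclidean_space (d e)) (open_disc (d e))) (subtopology X e) (\<phi> e)"
    using characteristic[OF assms] by (simp add: characteristic_map_def)
  have t: "topspace (subtopology (Euclidean_space (d e)) (open_disc (d e))) = open_disc (d e)"
    "topspace (subtopology X e) = e"
    using assms Union_cells by (auto simp: open_disc_def)
  show "\<phi> e ` open_disc (d e) = e" "inj_on (\<phi> e) (open_disc (d e))"
    using homeomorphic_imp_surjective_map[OF h] homeomorphic_imp_injective_map[OF h] t by auto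
qed

lemma closed_cell_eq: "e \<in> E \<Longrightarrow> \<phi> e ` closed_disc (d e) = e \<union> \<phi> e ` disc_boundary (d e)"
  by (simp add: closed_disc_eq image_Un open_cell)

text \<open>Along the ray to \<open>x\<close>, all parameters t < 1 land in the open cell. The
  parameters landing in its closure form a closed set, so t = 1 is among them. Hence subcomplexes
  described by closures of cells contain the closed cells.\<close>

lemma closed_cell_subset_closure:
  assumes e: "e \<in> E" shows "\<phi> e ` closed_disc (d e) \<subseteq> X closure_of e"
proof clarify
  fix x assume x: "x \<in> closed_disc (d e)"
  have e_sub: "e \<subseteq> X closure_of e"
    using e Union_cells by (intro closure_of_subset) auto
  have "continuous_map interval_space (disc_space (d e)) (\<lambda>t i. t * x i)"
    using x by (intro continuous_map_disc_scale)
      (auto simp: closed_disc_iff mult_le_one topspace_Euclidean_space intro: continuous_map_from_subtopology)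
  from continuous_map_compose[OF this continuous_characteristic[OF e]]
  have "continuous_map interval_space X (\<lambda>t. \<phi> e (\<lambda>i. t * x i))" by (simp add: o_def)
  then have "closedin interval_space {t \<in> topspace interval_space. \<phi> e (\<lambda>i. t * x i) \<in> X closure_of e}"
    by (rule closedin_continuous_map_preimage) simp
  then have "closed {t \<in> {0..1}. \<phi> e (\<lambda>i. t * x i) \<in> X closure_of e}"
    by (simp add: closedin_closed_eq)
  moreover have "{0..<1} \<subseteq> {t \<in> {0..1}. \<phi> e (\<lambda>i. t * x i) \<in> X closure_of e}"
  proof clarify
    fix t :: real assume t: "t \<in> {0..<1}"
    have "t * radius (d e) x \<le> t * 1" 
      using t x by (intro mult_left_mono) (auto simp: closed_disc_iff)
    then have "t * radius (d e) x < 1" using t by auto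
    then have "(\<lambda>i. t * x i) \<in> closed_disc (d e)" "(\<lambda>i. t * x i) \<notin> disc_boundary (d e)"
      using x t by (auto simp: closed_disc_iff disc_boundary_iff radius_scale)
    then have "(\<lambda>i. t * x i) \<in> open_disc (d e)"
      by (auto simp: closed_disc_eq)
    then have "\<phi> e (\<lambda>i. t * x i) \<in> X closure_of e"
      using e_sub open_cell(1)[OF e] by blast
    then show "t \<in> {0..1} \<and> \<phi> e (\<lambda>i. t * x i) \<in> X closure_of e" using t by auto
  qed
  ultimately have "closure {0..<1} \<subseteq> {t \<in> {0..1}. \<phi> e (\<lambda>i. t * x i) \<in> X closure_of e}"
    by (rule closure_minimal[rotated])
  then have "(1::real) \<in> {t \<in> {0..1}. \<phi> e (\<lambda>i. t * x i) \<in> X closure_of e}"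
    by (rule subsetD) simp
  then show "\<phi> e x \<in> X closure_of e" by simp
qed

lemma finite_subcomplex_closed_cell:
  "finite_subcomplex F \<Longrightarrow> e \<in> F \<Longrightarrow> \<phi> e ` closed_disc (d e) \<subseteq> \<Union>F"
  by (subst closed_cell_eq) (auto simp: finite_subcomplex_def)

lemma Union_finite_subcomplex:
  assumes "finite_subcomplex F" shows "\<Union>F = (\<Union>e\<in>F. \<phi> e ` closed_disc (d e))"
proof
  have "e \<subseteq> \<phi> e ` closed_disc (d e)" if "e \<in> F" for e
    using that assms by (subst closed_cell_eq) (auto simp: finite_subcomplex_def)
  then show "\<Union>F \<subseteq> (\<Union>e\<in>F. \<phi> e ` closed_disc (d e))" by blast
  show "(\<Union>e\<in>F. \<phi> e ` closed_disc (d e)) \<subseteq> \<Union>F"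
    using finite_subcomplex_closed_cell[OF assms] by blast
qed

lemma compactin_finite_subcomplex: 
  assumes "finite_subcomplex F" shows "compactin X (\<Union>F)"
proof -
  have "compactin X (\<phi> e ` closed_disc (d e))" if "e \<in> F" for e
    using that assms compact_disc_space[of "d e"] image_compactin[OF _ continuous_characteristic]
    by (metis compact_space_def finite_subcomplex_def subsetD topspace_disc_space)
  then show ?thesis
    unfolding Union_finite_subcomplex[OF assms] using assms
    by (intro compactin_Union) (auto simp: finite_subcomplex_def)
qed

lemma closedin_finite_subcomplex: "finite_subcomplex F \<Longrightarrow> closedin X (\<Union>F)"
  using compactin_finite_subcomplex Hausdorff compactin_imp_closedin by blast

lemma finite_subcomplex_empty: "finite_subcomplex {}"
  by (simp add: finite_subcomplex_def)

lemma finite_subcomplex_Union: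
  assumes "finite \<F>" and fs: "\<And>F. F \<in> \<F> \<Longrightarrow> finite_subcomplex F" 
  shows "finite_subcomplex (\<Union>\<F>)"
  unfolding finite_subcomplex_def
proof (intro conjI ballI)
  fix e assume "e \<in> \<Union>\<F>"
  then obtain F where F: "F \<in> \<F>" "e \<in> F" by blast
  then have "\<phi> e ` disc_boundary (d e) \<subseteq> \<Union>F" 
    using fs[OF F(1)] by (simp add: finite_subcomplex_def)
  also have "\<Union>F \<subseteq> \<Union>(\<Union>\<F>)" using F(1) by (intro Union_mono Union_upper)
  finally show "\<phi> e ` disc_boundary (d e) \<subseteq> \<Union>(\<Union>\<F>)" .
next
  show "\<Union>\<F> \<subseteq> E" "finite (\<Union>\<F>)"
    using assms by (meson Sup_least finite_Union finite_subcomplex_def)+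
qed

lemma finite_subcomplex_insert:
  assumes "finite_subcomplex F" "e \<in> E" "\<phi> e ` disc_boundary (d e) \<subseteq> \<Union>F"
  shows "finite_subcomplex (insert e F)"
  unfolding finite_subcomplex_def
proof (intro conjI ballI)
  fix c assume "c \<in> insert e F"
  then have "\<phi> c ` disc_boundary (d c) \<subseteq> \<Union>F" 
    using assms(3) assms(1)[unfolded finite_subcomplex_def] by (metis insertE)
  then show "\<phi> c ` disc_boundary (d c) \<subseteq> \<Union>(insert e F)" by auto
qed (use assms in \<open>auto simp: finite_subcomplex_def\<close>)

lemma cell_boundary:
  assumes "e \<in> E" 
  shows "\<exists>F\<subseteq>E. finite F \<and> (\<forall>c\<in>F. d c < d e) \<and> \<phi> e ` disc_boundary (d e) \<subseteq> \<Union>F"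
  using characteristic[OF assms] unfolding characteristic_map_def by blast

lemma cells_equal: 
  assumes "c \<in> E" "c' \<in> E" "y \<in> c" "y \<in> c'" shows "c = c'"
proof (rule ccontr)
  assume "c \<noteq> c'"
  then have "c \<inter> c' = {}" using assms disjoint_cells by (simp add: disjointD)
  then show False using assms by blast
qed

lemma new_cell_disjoint:
  assumes "finite_subcomplex (insert e G)" "e \<notin> G" shows "e \<inter> \<Union>G = {}"
proof (rule equals0I)
  fix y assume "y \<in> e \<inter> \<Union>G"
  then obtain c where c: "y \<in> e" "c \<in> G" "y \<in> c" by blast
  moreover have "e \<in> E" "c \<in> E" using assms(1) c by (auto simp: finite_subcomplex_def)
  ultimately have "e = c" by (intro cells_equal)
  then show False using c assms by simp
qed

text \<open>The boundary is covered by cells of smaller dimension, which are different from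
  \<open>e\<close> and hence disjoint from it.\<close>

lemma new_cell_boundary:
  assumes "finite_subcomplex (insert e G)" "x \<in> disc_boundary (d e)"
  shows "\<phi> e x \<in> \<Union>G"
proof -
  have e: "e \<in> E" using assms by (simp add: finite_subcomplex_def)
  obtain C where C: "C \<subseteq> E" "finite C" "\<And>c. c \<in> C \<Longrightarrow> d c < d e" "\<phi> e ` disc_boundary (d e) \<subseteq> \<Union>C"
    using cell_boundary[OF e] by blast
  then have "\<phi> e x \<in> \<Union>C" using assms(2) by (intro subsetD[OF C(4)] imageI)
  then obtain c where c: "c \<in> C" "\<phi> e x \<in> c" by (elim UnionE)
  moreover have "c \<noteq> e" using C(3)[OF c(1)] by auto
  ultimately have "\<phi> e x \<notin> e" using cells_equal[of c e] e C(1) by auto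
  have "\<phi> e ` disc_boundary (d e) \<subseteq> \<Union>(insert e G)"
    using assms(1) by (simp add: finite_subcomplex_def)
  from subsetD[OF this imageI[OF assms(2)]] have "\<phi> e x \<in> \<Union>(insert e G)" .
  then show ?thesis using \<open>\<phi> e x \<notin> e\<close> by simp
qed

text \<open>Induction on the dimension: finitely many cells of smaller dimension cover the boundary,
  and the union of finite subcomplexes around them can be enlarged by the cell.\<close>

lemma cell_in_finite_subcomplex:
  "e \<in> E \<Longrightarrow> \<exists>F. finite_subcomplex F \<and> e \<in> F"
proof (induction "d e" arbitrary: e rule: less_induct)
  case less
  obtain F where F: "F \<subseteq> E" "finite F" "\<And>c. c \<in> F \<Longrightarrow> d c < d e" 
    "\<phi> e ` disc_boundary (d e) \<subseteq> \<Union>F"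
    using cell_boundary[OF less.prems] by blast
  then have "\<forall>c\<in>F. \<exists>G. finite_subcomplex G \<and> c \<in> G"
    using less.hyps by blast
  then obtain G where G: "\<And>c. c \<in> F \<Longrightarrow> finite_subcomplex (G c) \<and> c \<in> G c"
    by metis
  then have U: "finite_subcomplex (\<Union>(G ` F))"
    using F by (intro finite_subcomplex_Union) auto
  have "\<Union>F \<subseteq> \<Union>(\<Union>(G ` F))" using G by blast
  with F(4) have "\<phi> e ` disc_boundary (d e) \<subseteq> \<Union>(\<Union>(G ` F))" by (rule subset_trans)
  then have "finite_subcomplex (insert e (\<Union>(G ` F)))"
    by (rule finite_subcomplex_insert[OF U less.prems])
  then show ?case by blast
qed

text \<open>The next cell is one of minimal dimension among those missing from \<open>G\<close>; the
  cells of \<open>F'\<close> that meet its boundary have smaller dimension and are therefore present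
  already.\<close>

lemma finite_subcomplex_induct [consumes 3, case_names base step]:
  assumes "finite_subcomplex F" "finite_subcomplex F'" "F \<subseteq> F'"
    and base: "P F"
    and step: "\<And>G e. finite_subcomplex G \<Longrightarrow> finite_subcomplex (insert e G) \<Longrightarrow> e \<notin> G \<Longrightarrow> F \<subseteq> G \<Longrightarrow> P G 
                 \<Longrightarrow> P (insert e G)"
  shows "P F'"
proof -
  have "P F'" if "finite_subcomplex G" "F \<subseteq> G" "G \<subseteq> F'" "P G" for G
    using that
  proof (induction "card (F' - G)" arbitrary: G rule: less_induct)
    case less
    show ?case
    proof (cases "G = F'")
      case False
      have fin: "finite (F' - G)" "F' - G \<noteq> {}" "F' \<subseteq> E"
        using False less.prems assms(2) by (auto simp: finite_subcomplex_def)
      then obtain e where e: "e \<in> F' - G" "\<And>c. c \<in> F' - G \<Longrightarrow> d e \<le> d c"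
        using ex_is_arg_min_if_finite[OF fin(1,2), of d] unfolding is_arg_min_linorder by blast
      have "e \<in> E" using e(1) fin(3) by blast
      obtain C where C: "C \<subseteq> E" "finite C" "\<And>c. c \<in> C \<Longrightarrow> d c < d e" "\<phi> e ` disc_boundary (d e) \<subseteq> \<Union>C"
        using cell_boundary[OF \<open>e \<in> E\<close>] by blast
      have "\<phi> e ` disc_boundary (d e) \<subseteq> \<Union>G"
      proof
        fix y assume y: "y \<in> \<phi> e ` disc_boundary (d e)"
        have "\<phi> e ` disc_boundary (d e) \<subseteq> \<Union>F'"
          using assms(2) e(1) by (simp add: finite_subcomplex_def)
        then have "y \<in> \<Union>F'" using y by (rule subsetD)
        moreover have "y \<in> \<Union>C" using C(4) y by (rule subsetD)
        ultimately obtain c c' where c: "c \<in> C" "y \<in> c" "c' \<in> F'" "y \<in> c'" by (elim UnionE)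
        then have "c = c'" using cells_equal C(1) fin(3) by (meson subsetD)
        then have "c \<notin> F' - G" using C(3)[OF c(1)] e(2) by fastforce
        then show "y \<in> \<Union>G" using c \<open>c = c'\<close> by blast
      qed
      then have fs: "finite_subcomplex (insert e G)"
        using less.prems(1) \<open>e \<in> E\<close> by (intro finite_subcomplex_insert)
      show ?thesis
      proof (rule less.hyps[OF _ fs])
        show "card (F' - insert e G) < card (F' - G)"
          using fin e(1) by (intro psubset_card_mono) auto
        show "P (insert e G)"
          using step[OF less.prems(1) fs] e(1) less.prems by blast
      qed (use less.prems e in auto)
    qed (use less.prems in simp)
  qed
  then show ?thesis using assms by blast
qed

end

section \<open>Maps and homotopies of n-ads, cell by cell\<close>

locale n_ad_cell_structure = cell_structure X E d \<phi>
  for X :: "'a topology" and E d \<phi> +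
  fixes n :: nat and A :: "nat \<Rightarrow> 'a set" and Y :: "'b topology" and B :: "nat \<Rightarrow> 'b set"
  assumes subcomplexes: "\<And>i. i \<in> {1..n} \<Longrightarrow> CW_subcomplex X E (A i)"
begin

text \<open>Only values on \<open>L\<close> matter, so a map on \<open>X\<close> serves as its own
  restriction to every subcomplex.\<close>

definition ad_map :: "'a set \<Rightarrow> ('a \<Rightarrow> 'b) \<Rightarrow> bool" where
  "ad_map L f \<longleftrightarrow> continuous_map (subtopology X L) Y f \<and> preserves_subsets n (\<lambda>i. A i \<inter> L) B f"

definition ad_homotopy :: "'a set \<Rightarrow> (real \<times> 'a \<Rightarrow> 'b) \<Rightarrow> bool" where
  "ad_homotopy L h \<longleftrightarrow> continuous_map (prod_topology interval_space (subtopology X L)) Y h \<and>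
     (\<forall>t\<in>{0..1}. preserves_subsets n (\<lambda>i. A i \<inter> L) B (\<lambda>x. h (t, x)))"

abbreviation ad_homotopic :: "'a set \<Rightarrow> ('a \<Rightarrow> 'b) \<Rightarrow> ('a \<Rightarrow> 'b) \<Rightarrow> bool" where
  "ad_homotopic L \<equiv> homotopic_with (preserves_subsets n (\<lambda>i. A i \<inter> L) B) (subtopology X L) Y"

text \<open>A cell that meets \<open>A i\<close> lies in it, so the subset conditions over one cell
  amount to landing in this intersection. An empty index set gives \<open>Y\<close> itself.\<close>

definition cell_target :: "'a set \<Rightarrow> 'b topology" where
  "cell_target e = subtopology Y (\<Inter>i\<in>{i\<in>{1..n}. e \<subseteq> A i}. B i)"

lemma ad_homotopicI:
  assumes "L \<subseteq> topspace X" "ad_homotopy L h" 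
    and "\<And>x. x \<in> L \<Longrightarrow> h (0, x) = f x" "\<And>x. x \<in> L \<Longrightarrow> h (1, x) = g x"
  shows "ad_homotopic L f g"
proof (subst homotopic_with)
  show "preserves_subsets n (\<lambda>i. A i \<inter> L) B p = preserves_subsets n (\<lambda>i. A i \<inter> L) B q"
    if "\<And>x. x \<in> topspace (subtopology X L) \<Longrightarrow> p x = q x" for p q
    using that assms(1) by (auto simp: preserves_subsets_def image_subset_iff subset_iff)
qed (use assms in \<open>auto simp: ad_homotopy_def\<close>)

lemma ad_homotopicE:
  assumes "ad_homotopic L f g" 
  obtains h where "ad_homotopy L h" "\<And>x. h (0, x) = f x" "\<And>x. h (1, x) = g x"
  using assms by (auto simp: homotopic_with_def ad_homotopy_def)

lemma ad_map_eq:
  assumes "ad_map L f" and "\<And>x. x \<in> L \<Longrightarrow> f x = g x" shows "ad_map L g"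
proof -
  have "continuous_map (subtopology X L) Y g"
    by (rule continuous_map_eq[of _ _ f]) (use assms in \<open>auto simp: ad_map_def\<close>)
  moreover have "g ` (A i \<inter> L) = f ` (A i \<inter> L)" for i
    using assms(2) by (intro image_cong) auto
  ultimately show ?thesis
    using assms(1) by (simp add: ad_map_def preserves_subsets_def)
qed

lemma ad_map_subset: "ad_map L f \<Longrightarrow> L' \<subseteq> L \<Longrightarrow> ad_map L' f"
  unfolding ad_map_def preserves_subsets_def 
  by (auto intro: continuous_map_from_subtopology_mono)

lemma ad_homotopy_const: "ad_map L f \<Longrightarrow> ad_homotopy L (\<lambda>z. f (snd z))"
  unfolding ad_map_def ad_homotopy_def by (auto simp: continuous_map_of_snd[unfolded o_def])

lemma ad_homotopy_slice: 
  assumes "ad_homotopy L h" "t \<in> {0..1}" shows "ad_map L (\<lambda>x. h (t, x))"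
  using continuous_map_o_Pair[of interval_space "subtopology X L" Y h t] assms 
  by (auto simp: ad_homotopy_def ad_map_def o_def)

lemma subset_topspace_finite_subcomplex: "finite_subcomplex F \<Longrightarrow> \<Union>F \<subseteq> topspace X"
  using compactin_finite_subcomplex compactin_subset_topspace by blast

lemma cell_in_or_disjoint:
  assumes "e \<in> E" "i \<in> {1..n}" "e \<inter> A i \<noteq> {}"
  shows "e \<subseteq> A i" "\<phi> e ` closed_disc (d e) \<subseteq> A i"
proof -
  obtain F where F: "F \<subseteq> E" "A i = \<Union>F" "\<And>e. e \<in> F \<Longrightarrow> X closure_of e \<subseteq> A i"
    using subcomplexes[OF assms(2)] by (auto simp: CW_subcomplex_def)
  then obtain c y where c: "c \<in> F" "y \<in> e" "y \<in> c" using assms(3) by blast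
  have "c \<in> E" using F(1) c(1) by (rule subsetD)
  from cells_equal[OF assms(1) this c(2,3)] have "e \<in> F" using c(1) by simp
  then show "e \<subseteq> A i" unfolding F(2) by (rule Union_upper)
  show "\<phi> e ` closed_disc (d e) \<subseteq> A i"
    using closed_cell_subset_closure[OF assms(1)] F(3)[OF \<open>e \<in> F\<close>] by (rule subset_trans)
qed

lemma cell_nonempty: "e \<in> E \<Longrightarrow> e \<noteq> {}"
  using open_cell(1) zero_in_open_disc by blast

lemma closed_cell_in_subcomplex: 
  "e \<in> E \<Longrightarrow> i \<in> {1..n} \<Longrightarrow> e \<subseteq> A i \<Longrightarrow> \<phi> e ` closed_disc (d e) \<subseteq> A i"
  using cell_in_or_disjoint(2) cell_nonempty by (metis inf.orderE)

lemma ad_map_on_cell: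
  assumes f: "ad_map L f" and e: "e \<in> E" and sub: "\<phi> e ` closed_disc (d e) \<subseteq> L"
  shows "continuous_map (disc_space (d e)) (cell_target e) (\<lambda>x. f (\<phi> e x))"
proof -
  have "continuous_map (disc_space (d e)) (subtopology X L) (\<phi> e)"
    using sub continuous_characteristic[OF e] by (auto simp: continuous_map_in_subtopology)
  then have "continuous_map (disc_space (d e)) Y (\<lambda>x. f (\<phi> e x))"
    using f continuous_map_compose unfolding ad_map_def o_def by blast
  moreover have "f (\<phi> e x) \<in> B i" if "x \<in> closed_disc (d e)" "i \<in> {1..n}" "e \<subseteq> A i" for x i
    using closed_cell_in_subcomplex[OF e that(2,3)] sub f that 
    unfolding ad_map_def preserves_subsets_def by blast
  ultimately show ?thesis
    unfolding cell_target_def continuous_map_in_subtopology topspace_disc_space by blast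
qed

text \<open>The points of the closed disc over \<open>\<Union>G\<close> are exactly the boundary
  points, so agreement there allows gluing. For the subset conditions, old points are governed by
  \<open>h\<close>, while a point of \<open>e\<close> in \<open>A i\<close> forces
  \<open>e \<subseteq> A i\<close>, and then \<open>cell_target e\<close> puts its value into
  \<open>B i\<close>.\<close>

lemma attach_cell:
  assumes G: "finite_subcomplex G" "finite_subcomplex (insert e G)" "e \<notin> G"
    and h: "ad_homotopy (\<Union>G) h" 
    and k: "continuous_map (prod_topology interval_space (disc_space (d e))) (cell_target e) k"
    and compat: "\<And>t x. t \<in> {0..1} \<Longrightarrow> x \<in> disc_boundary (d e) \<Longrightarrow> k (t, x) = h (t, \<phi> e x)"
  obtains H where "ad_homotopy (\<Union>(insert e G)) H" 
    "\<And>t y. t \<in> {0..1} \<Longrightarrow> y \<in> \<Union>G \<Longrightarrow> H (t, y) = h (t, y)"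
    "\<And>t x. t \<in> {0..1} \<Longrightarrow> x \<in> closed_disc (d e) \<Longrightarrow> H (t, \<phi> e x) = k (t, x)"
proof -
  have e: "e \<in> E" using G by (simp add: finite_subcomplex_def)
  have bd: "\<phi> e ` disc_boundary (d e) \<subseteq> \<Union>G"
    using new_cell_boundary[OF G(2)] by blast
  have union: "\<Union>G \<union> \<phi> e ` closed_disc (d e) = \<Union>(insert e G)"
    using bd unfolding closed_cell_eq[OF e] Union_insert by (simp add: Un_absorb2 Un_assoc Un_left_commute sup_commute)
  have open_cell_disc: "x \<in> open_disc (d e)" if "x \<in> closed_disc (d e)" "\<phi> e x \<notin> \<Union>G" for x
    using that bd by (auto simp: closed_disc_eq)
  have boundary: "x \<in> disc_boundary (d e)" if "x \<in> closed_disc (d e)" "\<phi> e x \<in> \<Union>G" for x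
    using that new_cell_disjoint[OF G(2,3)] open_cell(1)[OF e] by (auto simp: closed_disc_eq)
  obtain H where H: "continuous_map (prod_topology interval_space (subtopology X (\<Union>G \<union> \<phi> e ` closed_disc (d e)))) Y H"
    "\<And>t y. t \<in> {0..1} \<Longrightarrow> y \<in> \<Union>G \<Longrightarrow> H (t, y) = h (t, y)"
    "\<And>t x. t \<in> {0..1} \<Longrightarrow> x \<in> closed_disc (d e) \<Longrightarrow> H (t, \<phi> e x) = k (t, x)"
  proof (rule homotopy_extends_over_attached_cell[OF Hausdorff closedin_finite_subcomplex[OF G(1)] 
          continuous_characteristic[OF e], of Y h k])
    show "continuous_map (prod_topology interval_space (subtopology X (\<Union>G))) Y h"
      using h by (simp add: ad_homotopy_def)
    show "continuous_map (prod_topology interval_space (disc_space (d e))) Y k"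
      using k unfolding cell_target_def by (rule continuous_map_into_fulltopology)
    show "x = x'" if "x \<in> closed_disc (d e)" "x' \<in> closed_disc (d e)" "\<phi> e x \<notin> \<Union>G" "\<phi> e x = \<phi> e x'" for x x'
      using open_cell(2)[OF e] open_cell_disc that by (metis inj_onD)
  qed (use compat boundary in auto)
  have kB: "k (t, x) \<in> B i" if "t \<in> {0..1}" "x \<in> closed_disc (d e)" "i \<in> {1..n}" "e \<subseteq> A i" for t x i
  proof -
    have "(t, x) \<in> topspace (prod_topology interval_space (disc_space (d e)))"
      unfolding topspace_prod_topology topspace_disc_space using that by simp
    then have "k (t, x) \<in> topspace (cell_target e)"
      using k unfolding continuous_map_def by blast
    then show ?thesis using that unfolding cell_target_def by simp
  qed
  have "H (t, y) \<in> B i" if "t \<in> {0..1}" "i \<in> {1..n}" "y \<in> A i" "y \<in> \<Union>(insert e G)" for t y i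
  proof (cases "y \<in> \<Union>G")
    case True
    then show ?thesis 
      using h that H(2) unfolding ad_homotopy_def preserves_subsets_def by fastforce
  next
    case False
    then have "y \<in> e" using that by blast
    then have "e \<subseteq> A i" using cell_in_or_disjoint(1)[OF e that(2)] that by blast
    moreover obtain x where "x \<in> closed_disc (d e)" "y = \<phi> e x"
      using \<open>y \<in> e\<close> closed_cell_eq[OF e] by blast
    ultimately show ?thesis using kB that H(3) by simp
  qed
  then have "ad_homotopy (\<Union>(insert e G)) H"
    using H(1) unfolding union ad_homotopy_def preserves_subsets_def by blast
  from this H(2,3) show ?thesis by (rule that)
qed

text \<open>The cylinder over the disc retracts onto its bottom and side, where \<open>g\<close> and
  \<open>h\<close> are given. Over the cell the values are taken at points of the closed cell, which
  lies in every relevant \<open>A i\<close>, so the subset conditions persist.\<close>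

lemma extend_homotopy_cell:
  assumes G: "finite_subcomplex G" "finite_subcomplex (insert e G)" "e \<notin> G"
    and g: "ad_map (\<Union>(insert e G)) g" and h: "ad_homotopy (\<Union>G) h" 
    and h0: "\<And>x. x \<in> \<Union>G \<Longrightarrow> h (0, x) = g x"
  obtains H where "ad_homotopy (\<Union>(insert e G)) H" 
    "\<And>t y. t \<in> {0..1} \<Longrightarrow> y \<in> \<Union>G \<Longrightarrow> H (t, y) = h (t, y)"
    "\<And>y. y \<in> \<Union>(insert e G) \<Longrightarrow> H (0, y) = g y"
proof -
  let ?Z = "prod_topology interval_space (disc_space (d e))"
  let ?r = "\<lambda>z::real \<times> (nat \<Rightarrow> real). radius (d e) (snd z)"
  have e: "e \<in> E" using G by (simp add: finite_subcomplex_def)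
  have sub: "\<phi> e ` closed_disc (d e) \<subseteq> \<Union>(insert e G)"
    using finite_subcomplex_closed_cell[OF G(2)] by blast
  have bd: "\<phi> e x \<in> \<Union>G" if "x \<in> disc_boundary (d e)" for x
    using new_cell_boundary[OF G(2)] that by blast
  have snd: "continuous_map ?Z (disc_space (d e)) snd" 
    by (rule continuous_map_snd)
  have fst: "continuous_map ?Z euclideanreal fst" 
    using continuous_map_fst continuous_map_into_fulltopology by blast
  have rad: "continuous_map ?Z euclideanreal ?r"
    by (intro continuous_map_radius snd)
  \<comment> \<open>The retraction sends (t, x) with |x| = r to (0, (1 + t) x) on the bottom while
    (1 + t) r <= 1, and otherwise to the point x / r of the side at time (1 + t) r - 1. It fixes the
    bottom t = 0 and the side r = 1.\<close>
  define s where "s = (\<lambda>z. (1 + fst z) * ?r z)"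
  have cs: "continuous_map ?Z euclideanreal s"
    unfolding s_def by (intro continuous_intros fst rad)
  let ?Z1 = "subtopology ?Z {z \<in> topspace ?Z. s z \<le> 1}"
  let ?Z2 = "subtopology ?Z {z \<in> topspace ?Z. 1 \<le> s z}"
  \<comment> \<open>\<open>s z\<close> is at most twice the radius, so on the second branch the
    radius is at least 1/2 and the maximum equals it; elsewhere it keeps the factor
    continuous.\<close>
  define k where "k = (\<lambda>z. if s z \<le> 1 then g (\<phi> e (\<lambda>i. (1 + fst z) * snd z i)) 
     else h (s z - 1, \<phi> e (\<lambda>i. (1 / max (?r z) (1/2)) * snd z i)))"
  have Z: "fst z \<in> {0..1}" "snd z \<in> closed_disc (d e)" "0 \<le> ?r z" "?r z \<le> 1" if "z \<in> topspace ?Z" for z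
    using that by (auto simp: closed_disc_iff)
  have s_le: "s z \<le> 2 * ?r z" if "z \<in> topspace ?Z" for z
    unfolding s_def using Z[OF that] by (intro mult_right_mono) auto
  have outer_boundary: "(\<lambda>i. (1 / max (?r z) (1/2)) * snd z i) \<in> disc_boundary (d e)" 
    if "z \<in> topspace ?Z" "1 \<le> s z" for z
  proof -
    have "max (?r z) (1/2) = ?r z" "?r z \<noteq> 0" using s_le[OF that(1)] that(2) by linarith+
    then show ?thesis
      using Z[OF that(1)] by (simp add: disc_boundary_iff closed_disc_iff radius_scale[of "1 / ?r z", simplified])
  qed
  have "continuous_map ?Z (cell_target e) k"
    unfolding k_def
  proof (rule continuous_map_cases_le[OF cs])
    have "continuous_map ?Z1 (disc_space (d e)) (\<lambda>z i. (1 + fst z) * snd z i)"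
      by (rule continuous_map_disc_scale)
         (use Z in \<open>auto simp: s_def intro!: continuous_intros continuous_map_from_subtopology[OF fst] continuous_map_from_subtopology[OF snd]\<close>)
    from continuous_map_compose[OF this ad_map_on_cell[OF g e sub]]
    show "continuous_map ?Z1 (cell_target e) (\<lambda>z. g (\<phi> e (\<lambda>i. (1 + fst z) * snd z i)))"
      by (simp add: o_def)
    let ?m = "\<lambda>z i. (1 / max (?r z) (1/2)) * snd z i"
    have mp: "0 < max (?r z) (1/2)" for z by (simp add: less_max_iff_disj)
    have "continuous_map ?Z euclideanreal (\<lambda>z. 1 / max (?r z) (1/2))"
      using mp by (intro continuous_intros rad) (metis less_irrefl)
    then have "continuous_map ?Z (disc_space (d e)) ?m"
      using mp by (intro continuous_map_disc_scale[OF _ snd]) (simp_all add: less_imp_le divide_le_eq_1)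
    from continuous_map_compose[OF this continuous_characteristic[OF e]]
    have "continuous_map ?Z2 X (\<lambda>z. \<phi> e (?m z))"
      by (intro continuous_map_from_subtopology) (simp add: o_def)
    then have "continuous_map ?Z2 (subtopology X (\<Union>G)) (\<lambda>z. \<phi> e (?m z))"
      using outer_boundary bd by (auto simp: continuous_map_in_subtopology)
    moreover have "continuous_map ?Z2 interval_space (\<lambda>z. s z - 1)"
      using s_le Z by (fastforce simp: continuous_map_in_subtopology 
          intro!: continuous_intros continuous_map_from_subtopology[OF cs])
    ultimately have m: "continuous_map ?Z2 (prod_topology interval_space (subtopology X (\<Union>G))) (\<lambda>z. (s z - 1, \<phi> e (?m z)))"
      by (simp add: continuous_map_pairwise o_def)
    then have "continuous_map ?Z2 Y (\<lambda>z. h (s z - 1, \<phi> e (?m z)))"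
      using continuous_map_compose[OF m, of Y h] h by (simp add: ad_homotopy_def o_def)
    moreover have "h (s z - 1, \<phi> e (?m z)) \<in> B i" if "z \<in> topspace ?Z" "1 \<le> s z" "i \<in> {1..n}" "e \<subseteq> A i" for z i
    proof -
      have "\<phi> e (?m z) \<in> A i \<inter> \<Union>G"
        using closed_cell_in_subcomplex[OF e that(3,4)] outer_boundary[OF that(1,2)] bd by (auto simp: closed_disc_eq)
      moreover have "s z - 1 \<in> {0..1}" using s_le[OF that(1)] Z[OF that(1)] that by simp
      ultimately show ?thesis
        using h that(3) unfolding ad_homotopy_def preserves_subsets_def by blast
    qed
    ultimately show "continuous_map ?Z2 (cell_target e) (\<lambda>z. h (s z - 1, \<phi> e (?m z)))"
      by (auto simp: cell_target_def continuous_map_in_subtopology)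
    show "g (\<phi> e (\<lambda>i. (1 + fst z) * snd z i)) = h (s z - 1, \<phi> e (?m z))" if z: "z \<in> topspace ?Z" "s z = 1" for z
    proof -
      have "1 \<le> 2 * ?r z" using s_le[OF z(1)] z(2) by simp
      then have "1 / max (?r z) (1/2) = 1 / ?r z" by (simp add: max_def)
      also have "\<dots> = 1 + fst z" using z(2) \<open>1 \<le> 2 * ?r z\<close> by (simp add: s_def field_simps)
      finally show ?thesis using h0 bd[OF outer_boundary[OF z(1)]] z(2) by simp
    qed
  qed auto
  moreover have "k (t, x) = h (t, \<phi> e x)" if "t \<in> {0..1}" "x \<in> disc_boundary (d e)" for t x
    using that h0[OF bd[OF that(2)]] by (auto simp: k_def s_def disc_boundary_iff)
  ultimately obtain H where H: "ad_homotopy (\<Union>(insert e G)) H" 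
    "\<And>t y. t \<in> {0..1} \<Longrightarrow> y \<in> \<Union>G \<Longrightarrow> H (t, y) = h (t, y)"
    "\<And>t x. t \<in> {0..1} \<Longrightarrow> x \<in> closed_disc (d e) \<Longrightarrow> H (t, \<phi> e x) = k (t, x)"
    using attach_cell[OF G h] by metis
  have "H (0, y) = g y" if "y \<in> \<Union>(insert e G)" for y
  proof (cases "y \<in> \<Union>G")
    case True
    then show ?thesis using H(2)[of 0 y] h0 by simp
  next
    case False
    then have "y \<in> \<phi> e ` closed_disc (d e)" using that closed_cell_eq[OF e] by blast
    then obtain x where "x \<in> closed_disc (d e)" "y = \<phi> e x" by blast
    then show ?thesis using H(3)[of 0 x] by (simp add: k_def s_def closed_disc_iff)
  qed
  from H(1,2) this show ?thesis by (rule that)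
qed

end

section \<open>Finitely many homotopy classes on finite subcomplexes\<close>

context n_ad_cell_structure
begin

text \<open>Extensions of the same \<open>r\<close> differ only over the cell, where they are disc
  maps with equal boundary values. A homotopy of these relative to the boundary, glued to the
  constant homotopy on \<open>\<Union>G\<close>, joins the extensions.\<close>

lemma finite_classes_of_extensions:
  assumes G: "finite_subcomplex G" "finite_subcomplex (insert e G)" "e \<notin> G"
    and fin: "finite_homotopy_groups (cell_target e)"
  shows "\<exists>V. finite V \<and> (\<forall>g. ad_map (\<Union>(insert e G)) g \<longrightarrow> (\<forall>x\<in>\<Union>G. g x = r x) \<longrightarrow>
            (\<exists>v\<in>V. ad_homotopic (\<Union>(insert e G)) g v))"
proof -
  let ?L = "\<Union>(insert e G)"
  let ?D = "disc_space (d e)"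
  have e: "e \<in> E" using G by (simp add: finite_subcomplex_def)
  have sub: "\<phi> e ` closed_disc (d e) \<subseteq> ?L"
    using finite_subcomplex_closed_cell[OF G(2)] by blast
  let ?hom = "homotopic_with (\<lambda>f. \<forall>x\<in>disc_boundary (d e). f x = r (\<phi> e x)) ?D (cell_target e)"
  obtain U where U: "finite U" 
    "\<And>u. continuous_map ?D (cell_target e) u \<Longrightarrow> \<forall>x\<in>disc_boundary (d e). u x = r (\<phi> e x) \<Longrightarrow> \<exists>v\<in>U. ?hom u v"
    using finite_disc_map_classes[OF fin, of "d e" "\<lambda>x. r (\<phi> e x)"] by blast
  define Ext where "Ext = {g. ad_map ?L g \<and> (\<forall>x\<in>\<Union>G. g x = r x)}"
  have "\<exists>v\<in>U. ?hom (\<lambda>x. g (\<phi> e x)) v" if "g \<in> Ext" for g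
    using that new_cell_boundary[OF G(2)] by (intro U(2) ad_map_on_cell[OF _ e sub]) (auto simp: Ext_def)
  then have "\<forall>g\<in>Ext. \<exists>v. v \<in> U \<and> ?hom (\<lambda>x. g (\<phi> e x)) v" by blast
  from bchoice[OF this] obtain \<rho> where 
    \<rho>: "\<And>g. g \<in> Ext \<Longrightarrow> \<rho> g \<in> U" "\<And>g. g \<in> Ext \<Longrightarrow> ?hom (\<lambda>x. g (\<phi> e x)) (\<rho> g)"
    by blast
  have "\<exists>V\<subseteq>Ext. finite V \<and> (\<forall>g\<in>Ext. \<exists>v\<in>V. ad_homotopic ?L g v)"
  proof (rule finite_image_representatives)
    show "finite (\<rho> ` Ext)" using \<rho>(1) U(1) by (meson finite_subset image_subsetI)
    fix g g' assume g: "g \<in> Ext" "g' \<in> Ext" "\<rho> g = \<rho> g'"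
    have "?hom (\<lambda>x. g (\<phi> e x)) (\<lambda>x. g' (\<phi> e x))"
      using homotopic_with_trans[OF \<rho>(2)[OF g(1)]] homotopic_with_symD[OF \<rho>(2)[OF g(2)]] g(3) by simp
    then obtain k where k: "continuous_map (prod_topology interval_space ?D) (cell_target e) k"
      "\<And>x. k (0, x) = g (\<phi> e x)" "\<And>x. k (1, x) = g' (\<phi> e x)"
      "\<And>t x. t \<in> {0..1} \<Longrightarrow> x \<in> disc_boundary (d e) \<Longrightarrow> k (t, x) = r (\<phi> e x)"
      by (auto simp: homotopic_with_def)
    \<comment> \<open>\<open>r\<close> is an arbitrary function; continuity and the subset
      conditions on \<open>\<Union>G\<close> are inherited from its extension
      \<open>g\<close>.\<close>
    have "ad_map (\<Union>G) g" using g(1) by (auto simp: Ext_def intro: ad_map_subset)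
    then have "ad_map (\<Union>G) r" by (rule ad_map_eq) (use g(1) Ext_def in blast)
    then have r: "ad_homotopy (\<Union>G) (\<lambda>z. r (snd z))" by (rule ad_homotopy_const)
    obtain H where H: "ad_homotopy ?L H" 
      "\<And>t y. t \<in> {0..1} \<Longrightarrow> y \<in> \<Union>G \<Longrightarrow> H (t, y) = r (snd (t, y))"
      "\<And>t x. t \<in> {0..1} \<Longrightarrow> x \<in> closed_disc (d e) \<Longrightarrow> H (t, \<phi> e x) = k (t, x)"
      by (rule attach_cell[OF G r k(1)]) (simp_all add: k(4))
    have "H (0, y) = g y \<and> H (1, y) = g' y" if y: "y \<in> ?L" for y
    proof (cases "y \<in> \<Union>G")
      case True
      moreover from True have "g y = r y" "g' y = r y" using g(1,2) unfolding Ext_def by blast+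
      ultimately show ?thesis using H(2)[of _ y] by simp
    next
      case False
      then have "y \<in> \<phi> e ` closed_disc (d e)" using y closed_cell_eq[OF e] by blast
      then obtain x where "x \<in> closed_disc (d e)" "y = \<phi> e x" by blast
      then show ?thesis using H(3)[of _ x] k(2,3) by simp
    qed
    then show "ad_homotopic ?L g g'"
      by (intro ad_homotopicI[OF subset_topspace_finite_subcomplex[OF G(2)] H(1)]) auto
  qed
  then show ?thesis by (auto simp: Ext_def)
qed

lemma finite_homotopy_groups_cell_target:
  "n_ad_finite_homotopy_groups n Y B \<Longrightarrow> finite_homotopy_groups (cell_target e)"
  unfolding n_ad_finite_homotopy_groups_def cell_target_def by (erule allE, erule mp) auto

text \<open>Homotopy extension moves a map until its restriction to \<open>\<Union>G\<close> is one
  of finitely many representatives \<open>r\<close>, and the extensions of each \<open>r\<close>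
  fall into finitely many classes.\<close>

lemma finite_ad_homotopy_classes:
  assumes "n_ad_finite_homotopy_groups n Y B" and "finite_subcomplex F"
  shows "\<exists>R. finite R \<and> (\<forall>f. ad_map (\<Union>F) f \<longrightarrow> (\<exists>r\<in>R. ad_homotopic (\<Union>F) f r))"
  using finite_subcomplex_empty assms(2) empty_subsetI
proof (induction rule: finite_subcomplex_induct)
  case base
  \<comment> \<open>On the empty complex all functions are homotopic, so any single one represents
    them.\<close>
  have "ad_homotopic (\<Union>{}) f undefined" if "ad_map (\<Union>{}) f" for f
    using that by (intro homotopic_with_equal) (auto simp: ad_map_def preserves_subsets_def)
  then show ?case by (intro exI[of _ "{undefined}"]) blast
next
  case (step G e)
  let ?L = "\<Union>(insert e G)"
  obtain R where R: "finite R" "\<And>f. ad_map (\<Union>G) f \<Longrightarrow> \<exists>r\<in>R. ad_homotopic (\<Union>G) f r"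
    using step.IH by blast
  obtain V where V: "\<And>r. finite (V r)" "\<And>r g. ad_map ?L g \<Longrightarrow> \<forall>x\<in>\<Union>G. g x = r x \<Longrightarrow> \<exists>v\<in>V r. ad_homotopic ?L g v"
    using finite_classes_of_extensions[OF step.hyps(1-3) finite_homotopy_groups_cell_target[OF assms(1)]] by metis
  have "\<exists>v\<in>\<Union>(V ` R). ad_homotopic ?L f v" if f: "ad_map ?L f" for f
  proof -
    have "ad_map (\<Union>G) f" using f by (rule ad_map_subset) auto
    then obtain r where r: "r \<in> R" "ad_homotopic (\<Union>G) f r" using R(2) by blast
    obtain h where h: "ad_homotopy (\<Union>G) h" "\<And>x. h (0, x) = f x" "\<And>x. h (1, x) = r x"
      using ad_homotopicE[OF r(2)] by blast
    obtain H where H: "ad_homotopy ?L H" 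
      "\<And>t y. t \<in> {0..1} \<Longrightarrow> y \<in> \<Union>G \<Longrightarrow> H (t, y) = h (t, y)" "\<And>y. y \<in> ?L \<Longrightarrow> H (0, y) = f y"
      using extend_homotopy_cell[OF step.hyps(1-3) f h(1,2)] by metis
    have fH: "ad_homotopic ?L f (\<lambda>x. H (1, x))"
      by (rule ad_homotopicI[OF subset_topspace_finite_subcomplex[OF step.hyps(2)] H(1) H(3)]) auto
    have Hr: "\<forall>x\<in>\<Union>G. H (1, x) = r x" using H(2)[of 1] h(3) by simp
    have "ad_map ?L (\<lambda>x. H (1, x))" using H(1) by (rule ad_homotopy_slice) simp
    from V(2)[OF this Hr] obtain v where v: "v \<in> V r" "ad_homotopic ?L (\<lambda>x. H (1, x)) v" ..
    have "ad_homotopic ?L f v" using fH v(2) by (rule homotopic_with_trans)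
    moreover have "v \<in> \<Union>(V ` R)" using r(1) v(1) by blast
    ultimately show ?thesis by (rule bexI)
  qed
  then show ?case using R(1) V(1) by (intro exI[of _ "\<Union>(V ` R)"]) blast
qed

lemma extend_homotopy_finite:
  assumes "finite_subcomplex F" "finite_subcomplex F'" "F \<subseteq> F'"
    and g: "ad_map (topspace X) g" and h: "ad_homotopy (\<Union>F) h" 
    and h0: "\<And>x. x \<in> \<Union>F \<Longrightarrow> h (0, x) = g x"
  shows "\<exists>H. ad_homotopy (\<Union>F') H \<and> (\<forall>t\<in>{0..1}. \<forall>y\<in>\<Union>F. H (t, y) = h (t, y)) \<and> (\<forall>y\<in>\<Union>F'. H (0, y) = g y)"
  using assms(1-3)
proof (induction rule: finite_subcomplex_induct)
  case base
  then show ?case using h h0 by blast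
next
  case (step G e)
  from step.IH obtain h' where h': "ad_homotopy (\<Union>G) h'" "\<forall>t\<in>{0..1}. \<forall>y\<in>\<Union>F. h' (t, y) = h (t, y)" "\<forall>y\<in>\<Union>G. h' (0, y) = g y"
    by (elim exE conjE)
  have g': "ad_map (\<Union>(insert e G)) g"
    using ad_map_subset[OF g subset_topspace_finite_subcomplex[OF step.hyps(2)]] .
  obtain H where H: "ad_homotopy (\<Union>(insert e G)) H" 
      "\<And>t y. t \<in> {0..1} \<Longrightarrow> y \<in> \<Union>G \<Longrightarrow> H (t, y) = h' (t, y)" "\<And>y. y \<in> \<Union>(insert e G) \<Longrightarrow> H (0, y) = g y"
    by (rule extend_homotopy_cell[OF step.hyps(1-3) g' h'(1)]) (use h'(3) in auto)
  have "\<Union>F \<subseteq> \<Union>G" using step.hyps(4) by (rule Union_mono)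
  then have "H (t, y) = h (t, y)" if "t \<in> {0..1}" "y \<in> \<Union>F" for t y
    using H(2)[of t y] h'(2) that by (metis subsetD)
  with H(1,3) show ?case by (intro exI[of _ H]) simp
qed

end

section \<open>Exhaustion by finite subcomplexes\<close>

lemma (in cell_structure) exhaustion_by_finite_subcomplexes:
  assumes "countable E"
  shows "\<exists>K. K 0 = {} \<and> (\<forall>m. finite_subcomplex (K m) \<and> K m \<subseteq> K (Suc m)) \<and> (\<Union>m. K m) = E"
proof -
  obtain \<nu> :: "_ \<Rightarrow> nat" where \<nu>: "inj_on \<nu> E" using assms by (auto simp: countable_def)
  obtain F where F: "\<And>e. e \<in> E \<Longrightarrow> finite_subcomplex (F e) \<and> e \<in> F e"
    using cell_in_finite_subcomplex by metis
  \<comment> \<open>The strict inequality makes \<open>K 0\<close> empty, which later starts the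
    pigeonhole recursion.\<close>
  define K where "K = (\<lambda>m. \<Union>(F ` {e \<in> E. \<nu> e < m}))"
  have "finite {e \<in> E. \<nu> e < m}" for m
  proof (rule inj_on_finite[of \<nu> _ "{..<m}"])
    show "inj_on \<nu> {e \<in> E. \<nu> e < m}" using \<nu> by (rule inj_on_subset) auto
  qed auto
  then have fs: "finite_subcomplex (K m)" for m
    unfolding K_def using F by (intro finite_subcomplex_Union) auto
  have mono: "K m \<subseteq> K (Suc m)" for m
    unfolding K_def by (intro Union_mono image_mono) auto
  have "e \<in> K (Suc (\<nu> e))" if "e \<in> E" for e
    using F[OF that] that unfolding K_def by blast
  moreover have "K m \<subseteq> E" for m using fs by (simp add: finite_subcomplex_def)
  ultimately have "(\<Union>m. K m) = E" by blast
  then show ?thesis using fs mono by (intro exI[of _ K]) (simp add: K_def)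
qed

text \<open>This glues functions that stabilize pointwise: first homotopies over successive stages,
  later the limit map of the pigeonhole argument.\<close>

lemma eventual_values_limit:
  assumes mono: "\<And>i. S i \<subseteq> S (Suc i)" and step: "\<And>i x. x \<in> S i \<Longrightarrow> h (Suc i) x = h i x"
  obtains H where "\<And>i x. x \<in> S i \<Longrightarrow> H x = h i x"
proof
  have mono': "S i \<subseteq> S j" if "i \<le> j" for i j using lift_Suc_mono_le[of S, OF mono that] .
  have stable: "h j x = h i x" if "i \<le> j" "x \<in> S i" for i j x
    using that by (induction j rule: dec_induct) (use step mono' in \<open>auto simp: subset_iff\<close>)
  fix i x assume x: "x \<in> S i"
  let ?i = "LEAST i. x \<in> S i"
  have "?i \<le> i" "x \<in> S ?i" using x by (auto intro: Least_le LeastI)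
  \<comment> \<open>This fixes the witness \<open>H\<close>: the value at the first index whose set
    contains \<open>x\<close>.\<close>
  then show "h (LEAST i. x \<in> S i) x = h i x" using stable by simp
qed

section \<open>Path components of the function space\<close>

locale exhausted_n_ad = n_ad_cell_structure X E d \<phi> n A Y B
  for X :: "'a topology" and E d \<phi> n A and Y :: "'b topology" and B +
  fixes K :: "nat \<Rightarrow> 'a set set"
  assumes K0: "K 0 = {}" and K_finite: "\<And>m. finite_subcomplex (K m)" 
    and K_Suc: "\<And>m. K m \<subseteq> K (Suc m)" and K_exhausts: "(\<Union>m. K m) = E"
begin

abbreviation stage :: "nat \<Rightarrow> 'a set" where "stage m \<equiv> \<Union>(K m)"

abbreviation function_space :: "('a \<Rightarrow> 'b) topology" where
  "function_space \<equiv> n_ad_function_space n X A Y B"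

lemma K_mono: "i \<le> j \<Longrightarrow> K i \<subseteq> K j"
  using lift_Suc_mono_le[of K] K_Suc by blast

lemma stage_mono: "i \<le> j \<Longrightarrow> stage i \<subseteq> stage j"
  by (intro Union_mono K_mono)

lemma stage_subset: "stage m \<subseteq> topspace X"
  using subset_topspace_finite_subcomplex K_finite by blast

lemma in_some_stage: 
  assumes "x \<in> topspace X" obtains m where "x \<in> stage m"
proof -
  obtain e where e: "e \<in> E" "x \<in> e" using assms Union_cells by blast
  then obtain m where "e \<in> K m" using K_exhausts by blast
  with e(2) show ?thesis using that by blast
qed

text \<open>Every cell lies in a stage, which is closed and thus contains the closure of the cell,
  so the weak topology can be tested on stages.\<close>

lemma closedin_by_stages:
  assumes "C \<subseteq> topspace X" and C: "\<And>m. closedin X (C \<inter> stage m)" 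
  shows "closedin X C"
proof (rule weak_topology[OF assms(1)])
  fix e assume "e \<in> E"
  then obtain m where m: "e \<in> K m" using K_exhausts by blast
  then have "X closure_of e \<subseteq> stage m"
    using closedin_finite_subcomplex[OF K_finite] by (intro closure_of_minimal) auto
  then have "C \<inter> X closure_of e = (C \<inter> stage m) \<inter> X closure_of e" by blast
  then show "closedin X (C \<inter> X closure_of e)"
    using C[of m] closedin_Int closedin_closure_of by metis
qed

lemma ad_map_by_stages:
  assumes f: "\<And>m. ad_map (stage m) f" shows "ad_map (topspace X) f"
proof -
  have "continuous_map X Y f"
    unfolding continuous_map_closedin
  proof (intro conjI Pi_I allI impI)
    fix x assume "x \<in> topspace X"
    then obtain m where "x \<in> stage m" by (rule in_some_stage)
    then have "x \<in> topspace (subtopology X (stage m))" using stage_subset by auto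
    then show "f x \<in> topspace Y"
      using f[of m] unfolding ad_map_def continuous_map_def by blast
  next
    fix C assume C: "closedin Y C"
    show "closedin X {x \<in> topspace X. f x \<in> C}"
    proof (rule closedin_by_stages)
      fix m
      have "closedin (subtopology X (stage m)) {x \<in> topspace (subtopology X (stage m)). f x \<in> C}"
        using f[of m] C unfolding ad_map_def by (intro closedin_continuous_map_preimage) auto
      then have "closedin X {x \<in> topspace (subtopology X (stage m)). f x \<in> C}"
        using closedin_finite_subcomplex[OF K_finite] by (rule closedin_trans_full)
      moreover have "{x \<in> topspace (subtopology X (stage m)). f x \<in> C} = {x \<in> topspace X. f x \<in> C} \<inter> stage m"
        by auto
      ultimately show "closedin X ({x \<in> topspace X. f x \<in> C} \<inter> stage m)" by simp
    qed auto
  qed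
  moreover have "f x \<in> B i" if "i \<in> {1..n}" "x \<in> A i" "x \<in> topspace X" for i x
  proof -
    obtain m where "x \<in> stage m" using in_some_stage[OF \<open>x \<in> topspace X\<close>] .
    then show ?thesis using f[of m] that unfolding ad_map_def preserves_subsets_def by blast
  qed
  ultimately show ?thesis
    unfolding ad_map_def preserves_subsets_def by auto
qed

text \<open>Otherwise \<open>C\<close> contains a sequence all of whose tails are closed, which gives an open cover of
  \<open>C\<close> without a finite subcover.\<close>

lemma compactin_in_stage:
  assumes C: "compactin X C" shows "\<exists>m. C \<subseteq> stage m"
proof (rule ccontr)
  assume "\<nexists>m. C \<subseteq> stage m"
  then have "\<forall>m. \<exists>x. x \<in> C - stage m" by blast
  then obtain x where x: "\<And>m. x m \<in> C" "\<And>m. x m \<notin> stage m" by (metis DiffD1 DiffD2)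
  have C_sub: "C \<subseteq> topspace X" using C by (rule compactin_subset_topspace)
  have tail: "closedin X (x ` {m..})" for m
  proof (rule closedin_by_stages)
    fix j
    \<comment> \<open>Stages increase, so a term of the sequence in stage j has index below j; each
      stage meets the tail in a finite set.\<close>
    have "x ` {m..} \<inter> stage j \<subseteq> x ` {..j}"
    proof
      fix y assume "y \<in> x ` {m..} \<inter> stage j"
      then obtain i where y: "y = x i" "x i \<in> stage j" by blast
      then have "\<not> j \<le> i" using x(2)[of i] stage_mono[of j i] by (meson subsetD)
      then show "y \<in> x ` {..j}" using y(1) by simp
    qed
    then have "finite (x ` {m..} \<inter> stage j)" by (rule finite_subset) simp
    moreover have "x ` {m..} \<inter> stage j \<subseteq> topspace X" using stage_subset[of j] by (rule le_infI2)
    ultimately show "closedin X (x ` {m..} \<inter> stage j)"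
      using Hausdorff closedin_Hausdorff_finite by metis
  qed (use x C_sub in blast)
  let ?U = "(\<lambda>m. topspace X - x ` {m..}) ` UNIV"
  have "C \<subseteq> \<Union>?U"
  proof
    fix y assume "y \<in> C"
    then have "y \<in> topspace X" using C_sub by blast
    then obtain j where j: "y \<in> stage j" by (rule in_some_stage)
    have "y \<notin> x ` {j..}"
    proof clarify
      fix i assume "y = x i" "j \<le> i"
      then show False using x(2)[of i] stage_mono[of j i] j by (meson subsetD)
    qed
    then show "y \<in> \<Union>?U" using \<open>y \<in> topspace X\<close> by blast
  qed
  moreover have "\<forall>U\<in>?U. openin X U" using tail by auto
  ultimately have "\<exists>\<F>. finite \<F> \<and> \<F> \<subseteq> ?U \<and> C \<subseteq> \<Union>\<F>"
    using C[unfolded compactin_def, THEN conjunct2, rule_format, of ?U] by blast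
  then obtain \<F> where \<F>: "finite \<F>" "\<F> \<subseteq> ?U" "C \<subseteq> \<Union>\<F>" by (elim exE conjE)
  then obtain M where M: "finite M" "\<F> = (\<lambda>m. topspace X - x ` {m..}) ` M"
    using finite_subset_image by metis
  \<comment> \<open>Inserting 0 supplies an index even if \<open>M\<close> is empty; the term at the
    maximal index belongs to every tail removed by the finite subcover.\<close>
  have "x (Max (insert 0 M)) \<notin> topspace X - x ` {m..}" if "m \<in> M" for m
    using M(1) that by auto
  then show False using x(1)[of "Max (insert 0 M)"] \<F>(3) M(2) by blast
qed

lemma ad_homotopy_subset: 
  assumes "ad_homotopy L h" "L' \<subseteq> L" shows "ad_homotopy L' h"
proof -
  have "continuous_map (prod_topology interval_space (subtopology X L')) Y h"
    using assms unfolding ad_homotopy_def prod_topology_subtopology(2)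
    by (meson Sigma_mono continuous_map_from_subtopology_mono order_refl)
  then show ?thesis using assms unfolding ad_homotopy_def preserves_subsets_def by blast
qed

lemma ad_homotopy_eq:
  assumes h: "ad_homotopy L h" and eq: "\<And>t x. t \<in> {0..1} \<Longrightarrow> x \<in> L \<Longrightarrow> h (t, x) = h' (t, x)" 
  shows "ad_homotopy L h'"
proof -
  have "continuous_map (prod_topology interval_space (subtopology X L)) Y h'"
    by (rule continuous_map_eq[of _ _ h]) (use h eq in \<open>auto simp: ad_homotopy_def\<close>)
  moreover have "(\<lambda>x. h' (t, x)) ` (A i \<inter> L) = (\<lambda>x. h (t, x)) ` (A i \<inter> L)" if "t \<in> {0..1}" for i t
    using eq[OF that] by (intro image_cong) auto
  ultimately show ?thesis
    using h by (simp add: ad_homotopy_def preserves_subsets_def)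
qed

text \<open>Extensions over successive stages are chosen recursively and glued. Joint continuity is
  claimed stage by stage, which is the form that \<open>path_from_homotopy\<close> consumes.\<close>

lemma extend_homotopy:
  assumes g: "ad_map (topspace X) g" and h: "ad_homotopy (stage m) h" 
    and h0: "\<And>x. x \<in> stage m \<Longrightarrow> h (0, x) = g x"
  obtains H where "\<And>j. ad_homotopy (stage j) H" 
    "\<And>t x. t \<in> {0..1} \<Longrightarrow> x \<in> stage m \<Longrightarrow> H (t, x) = h (t, x)"
    "\<And>x. x \<in> topspace X \<Longrightarrow> H (0, x) = g x"
proof -
  \<comment> \<open>The last clause makes the recursion start at \<open>h\<close> itself, so that
    the limit agrees with it on \<open>stage m\<close>.\<close>
  define P where "P = (\<lambda>i H. ad_homotopy (stage (m + i)) H \<and> (\<forall>x\<in>stage (m + i). H (0, x) = g x) \<and> (i = 0 \<longrightarrow> H = h))"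
  define Q where "Q = (\<lambda>i H H'. \<forall>t\<in>{0..1::real}. \<forall>x\<in>stage (m + i). H' (t, x) = (H (t, x) :: 'b))"
  have "\<exists>f. \<forall>i. P i (f i) \<and> Q i (f i) (f (Suc i))"
  proof (rule dependent_nat_choice)
    show "\<exists>H. P 0 H" using h h0 by (auto simp: P_def)
    fix H i assume H: "P i H"
    have "\<exists>H'. ad_homotopy (stage (m + Suc i)) H' \<and> (\<forall>t\<in>{0..1}. \<forall>y\<in>stage (m + i). H' (t, y) = H (t, y)) 
            \<and> (\<forall>y\<in>stage (m + Suc i). H' (0, y) = g y)"
      using H by (intro extend_homotopy_finite[OF K_finite K_finite K_mono g]) (auto simp: P_def)
    then show "\<exists>H'. P (Suc i) H' \<and> Q i H H'" by (auto simp: P_def Q_def)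
  qed
  then obtain f where f: "\<And>i. P i (f i)" "\<And>i. Q i (f i) (f (Suc i))" by blast
  obtain H where H: "\<And>i z. z \<in> {0..1::real} \<times> stage (m + i) \<Longrightarrow> H z = f i z"
  proof (rule eventual_values_limit[of "\<lambda>i. {0..1::real} \<times> stage (m + i)" f])
    show "{0..1::real} \<times> stage (m + i) \<subseteq> {0..1} \<times> stage (m + Suc i)" for i
      using stage_mono[of "m + i" "m + Suc i"] by auto
    show "f (Suc i) z = f i z" if "z \<in> {0..1} \<times> stage (m + i)" for i z
      using f(2)[of i] that unfolding Q_def by auto
  qed blast
  show ?thesis
  proof
    fix j
    have "ad_homotopy (stage (m + j)) H"
    proof (rule ad_homotopy_eq)
      show "ad_homotopy (stage (m + j)) (f j)" using f(1)[of j] unfolding P_def by (rule conjunct1)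
      show "f j (t, x) = H (t, x)" if "t \<in> {0..1}" "x \<in> stage (m + j)" for t x
        using H[OF SigmaI[OF that]] by simp
    qed
    then show "ad_homotopy (stage j) H" using stage_mono by (rule ad_homotopy_subset) simp
  next
    show "H (t, x) = h (t, x)" if "t \<in> {0..1}" "x \<in> stage m" for t x
      using H[of "(t, x)" 0] f(1)[of 0] that unfolding P_def by auto
  next
    fix x assume "x \<in> topspace X"
    then obtain j where "x \<in> stage j" by (rule in_some_stage)
    then have x: "x \<in> stage (m + j)" using stage_mono[of j "m + j"] by auto
    then show "H (0, x) = g x"
      using H[of "(0, x)" j] f(1)[of j] unfolding P_def by auto
  qed
qed

lemma subcomplex_subset: "i \<in> {1..n} \<Longrightarrow> A i \<subseteq> topspace X"
  using subcomplexes Union_cells unfolding CW_subcomplex_def by (metis Union_mono)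

lemma topspace_function_space:
  "f \<in> topspace function_space \<longleftrightarrow> f \<in> extensional (topspace X) \<and> ad_map (topspace X) f"
proof -
  have "preserves_subsets n (\<lambda>i. A i \<inter> topspace X) B f \<longleftrightarrow> preserves_subsets n A B f"
    unfolding preserves_subsets_def using subcomplex_subset by (intro ball_cong) (auto simp: Int_absorb2)
  then show ?thesis
    by (auto simp: n_ad_function_space_def topspace_compact_open_topology maps_def ad_map_def)
qed

text \<open>A subbasic open set tests a compact \<open>C\<close>, which lies in a stage, where
  \<open>H\<close> is jointly continuous. The parameters failing the test form the projection of a
  closed set along the compact factor \<open>C\<close>, hence a closed set.\<close>

lemma path_from_homotopy:
  assumes H: "\<And>j. ad_homotopy (stage j) H" 
  shows "path_component_of function_space (restrict (\<lambda>x. H (0, x)) (topspace X)) (restrict (\<lambda>x. H (1, x)) (topspace X))"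
proof -
  let ?p = "\<lambda>t. restrict (\<lambda>x. H (t, x)) (topspace X)"
  have top: "?p t \<in> topspace function_space" if "t \<in> {0..1}" for t
  proof -
    have "ad_map (topspace X) (\<lambda>x. H (t, x))"
      using H that by (intro ad_map_by_stages ad_homotopy_slice)
    then have "ad_map (topspace X) (?p t)" by (rule ad_map_eq) simp
    then show ?thesis by (simp add: topspace_function_space)
  qed
  have "continuous_map interval_space (compact_open_topology X Y) ?p"
    unfolding compact_open_topology_def
  proof (rule continuous_on_generated_topo)
    let ?S = "{{f \<in> maps X Y. f ` K \<subseteq> U} |K U. compactin X K \<and> openin Y U}"
    have "\<Union>?S = maps X Y"
      using topspace_compact_open_topology[of X Y] 
      unfolding compact_open_topology_def topology_generated_by_topspace .
    then show "?p ` topspace interval_space \<subseteq> \<Union>?S"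
      using top by (auto simp: n_ad_function_space_def topspace_compact_open_topology)
    fix V assume "V \<in> ?S"
    then obtain C U where V: "V = {f \<in> maps X Y. f ` C \<subseteq> U}" and C: "compactin X C" and U: "openin Y U" by blast
    obtain m where m: "C \<subseteq> stage m" using compactin_in_stage[OF C] by blast
    have C_sub: "C \<subseteq> topspace X" using C by (rule compactin_subset_topspace)
    let ?Z = "prod_topology interval_space (subtopology X C)"
    have "ad_homotopy C H" using H m by (rule ad_homotopy_subset)
    then have cont: "continuous_map ?Z Y H" by (simp add: ad_homotopy_def)
    then have "closedin ?Z {z \<in> topspace ?Z. H z \<in> topspace Y - U}"
      using U by (intro closedin_continuous_map_preimage) auto
    moreover have "closed_map ?Z interval_space fst"
      using C by (intro closed_map_fst) (simp add: compact_space_subtopology)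
    ultimately have "closedin interval_space (fst ` {z \<in> topspace ?Z. H z \<in> topspace Y - U})"
      by (simp add: closed_map_def)
    then have "openin interval_space (topspace interval_space - fst ` {z \<in> topspace ?Z. H z \<in> topspace Y - U})"
      by blast
    moreover have "?p -` V \<inter> topspace interval_space = topspace interval_space - fst ` {z \<in> topspace ?Z. H z \<in> topspace Y - U}"
    proof -
      have HY: "H (t, x) \<in> topspace Y" if "t \<in> {0..1}" "x \<in> C" for t x
      proof -
        have "(t, x) \<in> topspace ?Z" using that C_sub by auto
        then show ?thesis using cont unfolding continuous_map_def by blast
      qed
      have "?p t \<in> V \<longleftrightarrow> (\<forall>x\<in>C. H (t, x) \<in> U)" if "t \<in> {0..1}" for t
      proof -
        have "?p t \<in> maps X Y" 
          using top[OF that] by (simp add: n_ad_function_space_def topspace_compact_open_topology)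
        moreover have "?p t ` C = (\<lambda>x. H (t, x)) ` C" using C_sub by (intro image_cong) auto
        ultimately show ?thesis unfolding V by auto
      qed
      moreover have "topspace ?Z = {0..1} \<times> C" using C_sub by auto
      then have "fst ` {z \<in> topspace ?Z. H z \<in> topspace Y - U} = {t \<in> {0..1}. \<exists>x\<in>C. H (t, x) \<notin> U}"
        using HY by (force simp: image_iff)
      ultimately show ?thesis by auto
    qed
    ultimately show "openin interval_space (?p -` V \<inter> topspace interval_space)" by simp
  qed
  moreover have "?p t \<in> {f. preserves_subsets n A B f}" if "t \<in> {0..1}" for t
    using top[OF that] by (simp add: n_ad_function_space_def)
  ultimately have "pathin function_space ?p"
    unfolding pathin_def n_ad_function_space_def continuous_map_in_subtopology by auto
  then show ?thesis unfolding path_component_of_def by blast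
qed

lemma approximation_by_stages:
  assumes U: "openin function_space U" "f \<in> U" and g: "\<And>m. g m \<in> topspace function_space"
    and gf: "\<And>m x. x \<in> stage m \<Longrightarrow> g m x = f x"
  shows "\<exists>m. g m \<in> U"
proof -
  let ?S = "{{f \<in> maps X Y. f ` K \<subseteq> U} |K U. compactin X K \<and> openin Y U}"
  obtain U' where U': "openin (compact_open_topology X Y) U'" "U = U' \<inter> {f. preserves_subsets n A B f}"
    using U(1) by (auto simp: n_ad_function_space_def openin_subtopology)
  have gm: "g m \<in> maps X Y" "preserves_subsets n A B (g m)" for m
    using g[of m] by (auto simp: n_ad_function_space_def topspace_compact_open_topology)
  have "generate_topology_on ?S U'" 
    using U'(1) unfolding compact_open_topology_def by (rule openin_topology_generated_by)
  \<comment> \<open>Eventual membership, rather than membership of one \<open>g m\<close>, is what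
    survives finite intersections. A subbasic set tests a compact set inside some stage, and from
    that index on \<open>g m\<close> equals \<open>f\<close> there.\<close>
  then have "f \<in> U' \<longrightarrow> (\<exists>N. \<forall>m\<ge>N. g m \<in> U')"
  proof (induction rule: generate_topology_on.induct)
    case (Int a b)
    show ?case
    proof
      assume "f \<in> a \<inter> b"
      then obtain M N where "\<forall>m\<ge>M. g m \<in> a" "\<forall>m\<ge>N. g m \<in> b" using Int.IH by blast
      then show "\<exists>N. \<forall>m\<ge>N. g m \<in> a \<inter> b" by (intro exI[of _ "max M N"]) simp
    qed
  next
    case (UN \<U>)
    show ?case
    proof
      assume "f \<in> \<Union>\<U>"
      then obtain k where k: "k \<in> \<U>" "f \<in> k" ..
      then obtain N where "\<forall>m\<ge>N. g m \<in> k" using UN.IH by blast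
      then show "\<exists>N. \<forall>m\<ge>N. g m \<in> \<Union>\<U>" using k(1) by blast
    qed
  next
    case (Basis s)
    then obtain C V where s: "s = {f \<in> maps X Y. f ` C \<subseteq> V}" and C: "compactin X C" by blast
    obtain N where N: "C \<subseteq> stage N" using compactin_in_stage[OF C] by blast
    show ?case
    proof (intro impI exI allI)
      fix m assume "f \<in> s" "N \<le> m"
      have "g m x = f x" if "x \<in> C" for x
        using gf that N stage_mono[OF \<open>N \<le> m\<close>] by (metis subsetD)
      then have "g m ` C = f ` C" by (intro image_cong) auto
      then show "g m \<in> s" using \<open>f \<in> s\<close> gm unfolding s by auto
    qed
  qed simp
  then show ?thesis using U(2) U'(2) gm(2) by auto
qed

end

section \<open>Openness of path components\<close>

lemma cell_structure_of_CW_complex: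
  assumes "CW_complex X E" shows "\<exists>d \<phi>. cell_structure X E d \<phi>"
proof -
  have "\<exists>d. \<forall>e\<in>E. \<exists>\<phi>. characteristic_map X E d e \<phi>"
    using assms by (simp only: CW_complex_def)
  then obtain d where d: "\<forall>e\<in>E. \<exists>\<phi>. characteristic_map X E d e \<phi>" ..
  from bchoice[OF d] obtain \<phi> where "\<forall>e\<in>E. characteristic_map X E d e (\<phi> e)" ..
  then have "cell_structure X E d \<phi>"
    using assms unfolding CW_complex_def cell_structure_def by simp
  then show ?thesis by blast
qed

text \<open>A closed cell is path-connected, so it lies in \<open>P\<close> or misses it. The
  complement of \<open>P\<close> thus meets the closure of each cell in nothing or in all of it, and
  is closed by the weak topology.\<close>

lemma (in cell_structure) openin_path_component:
  assumes P: "P \<in> path_components_of X" shows "openin X P"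
proof -
  have "closedin X (topspace X - P)"
  proof (rule weak_topology)
    fix e assume e: "e \<in> E"
    let ?D = "\<phi> e ` closed_disc (d e)"
    have "compactin (disc_space (d e)) (closed_disc (d e))" "path_connectedin (disc_space (d e)) (closed_disc (d e))"
      using compact_disc_space[of "d e"] path_connected_disc_space[of "d e"] 
      by (metis compact_space_def topspace_disc_space, metis path_connectedin_topspace topspace_disc_space)
    then have "compactin X ?D" and D: "path_connectedin X ?D"
      using continuous_characteristic[OF e] image_compactin path_connectedin_continuous_map_image by metis+
    then have "closedin X ?D" using Hausdorff compactin_imp_closedin by blast
    moreover have "e \<subseteq> ?D" using closed_cell_eq[OF e] by blast
    ultimately have closure: "X closure_of e \<subseteq> ?D" by (intro closure_of_minimal)
    have "?D \<subseteq> P \<or> ?D \<inter> P = {}"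
      using path_components_of_maximal[OF P D] by (auto simp: disjnt_def)
    moreover have "X closure_of e \<subseteq> topspace X" by (rule closure_of_subset_topspace)
    ultimately have "(topspace X - P) \<inter> X closure_of e = {} \<or> (topspace X - P) \<inter> X closure_of e = X closure_of e"
      using closure by blast
    then show "closedin X ((topspace X - P) \<inter> X closure_of e)"
      using closedin_closure_of closedin_empty by metis
  qed auto
  then show ?thesis 
    using openin_closedin_eq path_components_of_subset[OF P] by blast
qed

text \<open>A homotopy from \<open>g \<circ> f\<close> to the identity joins each point to its
  image, so \<open>f\<close> separates path components and \<open>P\<close> is the preimage of a
  single component of \<open>W\<close>.\<close>

lemma openin_path_component_homotopy_equivalent:
  assumes "X homotopy_equivalent_space W" and open_W: "\<And>Q. Q \<in> path_components_of W \<Longrightarrow> openin W Q"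
    and P: "P \<in> path_components_of X"
  shows "openin X P"
proof -
  obtain f g where f: "continuous_map X W f" and g: "continuous_map W X g"
    and gf: "homotopic_with (\<lambda>x. True) X X (g \<circ> f) id"
    using assms(1) unfolding homotopy_equivalent_space_def by blast
  obtain p where p: "p \<in> topspace X" "P = path_component_of_set X p"
    using P by (auto simp: path_components_of_def)
  obtain h where h: "continuous_map (prod_topology interval_space X) X h" 
    "\<And>x. h (0, x) = g (f x)" "\<And>x. h (1, x) = x"
    using gf unfolding homotopic_with_def by auto
  have homotopy: "path_component_of X (g (f x)) x" if "x \<in> topspace X" for x
    unfolding path_component_of_def pathin_def
  proof (intro exI conjI)
    have "continuous_map interval_space (prod_topology interval_space X) (\<lambda>t. (t, x))"
      using that by (simp add: continuous_map_pairwise o_def)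
    from continuous_map_compose[OF this h(1)]
    show "continuous_map interval_space X (\<lambda>t. h (t, x))" by (simp add: o_def)
  qed (use h in auto)
  let ?Q = "path_component_of_set W (f p)"
  have "f p \<in> topspace W" using f p(1) by (auto simp: continuous_map_def)
  then have "openin W ?Q" by (intro open_W) (auto simp: path_components_of_def)
  then have "openin X {x \<in> topspace X. f x \<in> ?Q}"
    by (rule openin_continuous_map_preimage[OF f])
  moreover have "path_component_of X p x \<longleftrightarrow> path_component_of W (f p) (f x)" if x: "x \<in> topspace X" for x
  proof
    assume "path_component_of W (f p) (f x)"
    then have "path_component_of X (g (f p)) (g (f x))"
      by (rule path_component_of_continuous_image[OF g])
    then show "path_component_of X p x"
      using homotopy[OF p(1)] homotopy[OF x] by (meson path_component_of_sym path_component_of_trans)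
  qed (rule path_component_of_continuous_image[OF f])
  then have "{x \<in> topspace X. f x \<in> ?Q} = P"
    using path_component_of_subset_topspace[of X p] by (auto simp: p(2))
  ultimately show ?thesis by simp
qed

section \<open>The pigeonhole argument\<close>

context exhausted_n_ad
begin

text \<open>Extended over all stages, the homotopy becomes a path in the function space that starts
  at \<open>g\<close>; its endpoint has the prescribed values on the stage and stays in
  \<open>P\<close>.\<close>

lemma move_within_path_component:
  assumes P: "P \<in> path_components_of function_space" "g \<in> P" 
    and hom: "ad_homotopic (stage m) g r"
  shows "\<exists>g'\<in>P. \<forall>x\<in>stage m. g' x = r x"
proof -
  obtain h where h: "ad_homotopy (stage m) h" "\<And>x. h (0, x) = g x" "\<And>x. h (1, x) = r x"
    using ad_homotopicE[OF hom] by blast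
  have g: "g \<in> extensional (topspace X)" "ad_map (topspace X) g"
    using P path_components_of_subset topspace_function_space by blast+
  obtain H where H: "\<And>j. ad_homotopy (stage j) H" 
    "\<And>t x. t \<in> {0..1} \<Longrightarrow> x \<in> stage m \<Longrightarrow> H (t, x) = h (t, x)"
    "\<And>x. x \<in> topspace X \<Longrightarrow> H (0, x) = g x"
    using extend_homotopy[OF g(2) h(1,2)] by metis
  let ?g = "restrict (\<lambda>x. H (1, x)) (topspace X)"
  have "restrict (\<lambda>x. H (0, x)) (topspace X) = g"
    using H(3) g(1) by (auto simp: extensional_def)
  then have "path_component_of function_space g ?g"
    using path_from_homotopy[OF H(1)] by simp
  then have "?g \<in> P"
    using P by (auto simp: path_components_of_def intro: path_component_of_trans)
  moreover have "?g x = r x" if "x \<in> stage m" for x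
  proof -
    have "x \<in> topspace X" using stage_subset that by blast
    then show ?thesis using H(2)[of 1 x] h(3) that by simp
  qed
  ultimately show ?thesis by blast
qed

lemma finite_path_components:
  assumes fin: "n_ad_finite_homotopy_groups n Y B"
    and open_components: "\<And>P. P \<in> path_components_of function_space \<Longrightarrow> openin function_space P"
  shows "finite (path_components_of function_space)"
proof (rule ccontr)
  let ?\<Pi> = "path_components_of function_space"
  assume inf: "infinite ?\<Pi>"
  define near where "near = (\<lambda>m f. {P \<in> ?\<Pi>. \<exists>g\<in>P. \<forall>x\<in>stage m. g x = f x})"
  define good where "good = (\<lambda>m f. f \<in> topspace function_space \<and> infinite (near m f))"
  have "\<exists>F. \<forall>m. good m (F m) \<and> (\<forall>x\<in>stage m. F (Suc m) x = F m x)"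
  proof (rule dependent_nat_choice)
    obtain P where P: "P \<in> ?\<Pi>" using inf by (metis finite.emptyI ex_in_conv)
    then obtain f where f: "f \<in> P" using nonempty_path_components_of by blast
    \<comment> \<open>Stage 0 is empty, so agreement on it is no condition.\<close>
    have "near 0 f = ?\<Pi>"
      using nonempty_path_components_of by (fastforce simp: near_def K0)
    then show "\<exists>f. good 0 f"
      using inf f P path_components_of_subset unfolding good_def by fastforce
  next
    fix f m assume "good m f"
    then have inf_near: "infinite (near m f)" by (simp add: good_def)
    have "\<forall>P\<in>near m f. \<exists>g. g \<in> P \<and> (\<forall>x\<in>stage m. g x = f x)" by (auto simp: near_def)
    from bchoice[OF this] obtain \<gamma> 
      where \<gamma>: "\<And>P. P \<in> near m f \<Longrightarrow> \<gamma> P \<in> P" "\<And>P x. P \<in> near m f \<Longrightarrow> x \<in> stage m \<Longrightarrow> \<gamma> P x = f x"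
      by blast
    have near_sub: "P \<in> ?\<Pi>" if "P \<in> near m f" for P using that by (simp add: near_def)
    have \<gamma>_top: "\<gamma> P \<in> topspace function_space" if "P \<in> near m f" for P
      using \<gamma>(1)[OF that] path_components_of_subset[OF near_sub[OF that]] by blast
    obtain R where R: "finite R" "\<And>g. ad_map (stage (Suc m)) g \<Longrightarrow> \<exists>r\<in>R. ad_homotopic (stage (Suc m)) g r"
      using finite_ad_homotopy_classes[OF fin K_finite] by metis
    have "\<exists>r. r \<in> R \<and> ad_homotopic (stage (Suc m)) (\<gamma> P) r" if "P \<in> near m f" for P
    proof -
      have "ad_map (stage (Suc m)) (\<gamma> P)"
        using \<gamma>_top[OF that] stage_subset unfolding topspace_function_space by (blast intro: ad_map_subset)
      then show ?thesis using R(2) by blast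
    qed
    then have "\<forall>P\<in>near m f. \<exists>r. r \<in> R \<and> ad_homotopic (stage (Suc m)) (\<gamma> P) r" by blast
    from bchoice[OF this] obtain \<rho> 
      where \<rho>: "\<And>P. P \<in> near m f \<Longrightarrow> \<rho> P \<in> R" "\<And>P. P \<in> near m f \<Longrightarrow> ad_homotopic (stage (Suc m)) (\<gamma> P) (\<rho> P)"
      by blast
    have "finite (\<rho> ` near m f)" using \<rho>(1) R(1) by (meson finite_subset image_subsetI)
    \<comment> \<open>The components near \<open>f\<close> are sorted by the class, on the next
      stage, of a chosen member. For a class occurring infinitely often, the next map is the chosen
      member \<open>\<gamma> P0\<close>: it agrees with \<open>f\<close> on \<open>stage m\<close>,
      and every component of that class contains a map agreeing with it on the next stage.\<close>
    then obtain P0 where P0: "P0 \<in> near m f" "infinite {P \<in> near m f. \<rho> P = \<rho> P0}"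
      using pigeonhole_infinite[OF inf_near] by blast
    have "P \<in> near (Suc m) (\<gamma> P0)" if P: "P \<in> near m f" "\<rho> P = \<rho> P0" for P
    proof -
      have "ad_homotopic (stage (Suc m)) (\<rho> P) (\<gamma> P0)"
        using homotopic_with_symD[OF \<rho>(2)[OF P0(1)]] P(2) by simp
      then have "ad_homotopic (stage (Suc m)) (\<gamma> P) (\<gamma> P0)"
        by (rule homotopic_with_trans[OF \<rho>(2)[OF P(1)]])
      from move_within_path_component[OF near_sub[OF P(1)] \<gamma>(1)[OF P(1)] this]
      show ?thesis using near_sub[OF P(1)] by (simp add: near_def)
    qed
    then have "{P \<in> near m f. \<rho> P = \<rho> P0} \<subseteq> near (Suc m) (\<gamma> P0)" by blast
    then have "good (Suc m) (\<gamma> P0)"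
      using P0 \<gamma>_top[OF P0(1)] finite_subset unfolding good_def by blast
    then show "\<exists>f'. good (Suc m) f' \<and> (\<forall>x\<in>stage m. f' x = f x)"
      using \<gamma>(2)[OF P0(1)] by blast
  qed
  then obtain F where F: "\<And>m. good m (F m)" "\<And>m x. x \<in> stage m \<Longrightarrow> F (Suc m) x = F m x"
    by blast
  obtain f where f: "\<And>m x. x \<in> stage m \<Longrightarrow> f x = F m x"
    by (rule eventual_values_limit[of stage F]) (use stage_mono F(2) in auto)
  \<comment> \<open>The pointwise limit becomes a point of the function space only after its values
    off \<open>topspace X\<close> are reset.\<close>
  define f' where "f' = restrict f (topspace X)"
  have f': "f' x = F m x" if "x \<in> stage m" for m x
    using f[OF that] stage_subset[of m] that unfolding f'_def by (metis restrict_apply' subsetD)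
  have "ad_map (stage m) f'" for m
  proof -
    have "ad_map (topspace X) (F m)" using F(1)[of m] by (simp add: good_def topspace_function_space)
    then have "ad_map (stage m) (F m)" using stage_subset by (rule ad_map_subset)
    then show ?thesis by (rule ad_map_eq) (simp only: f')
  qed
  then have "f' \<in> topspace function_space"
    by (auto simp: topspace_function_space f'_def intro: ad_map_by_stages)
  then have "f' \<in> \<Union>?\<Pi>" unfolding Union_path_components_of .
  then obtain P where P: "P \<in> ?\<Pi>" "f' \<in> P" ..
  have "\<exists>g. \<exists>Q\<in>?\<Pi>. Q \<noteq> P \<and> g \<in> Q \<and> (\<forall>x\<in>stage m. g x = f' x)" for m
  proof -
    \<comment> \<open>Infinitely many components come close to \<open>f'\<close> on each stage, so
      one of them differs from \<open>P\<close>.\<close>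
    have "infinite (near m (F m))" using F(1) by (simp add: good_def)
    then have "\<not> near m (F m) \<subseteq> {P}" using finite_subset by blast
    then obtain Q where "Q \<in> near m (F m)" "Q \<noteq> P" by blast
    then show ?thesis using f' unfolding near_def by fastforce
  qed
  then obtain g where g: "\<And>m. \<exists>Q\<in>?\<Pi>. Q \<noteq> P \<and> g m \<in> Q" "\<And>m x. x \<in> stage m \<Longrightarrow> g m x = f' x"
    by metis
  have g_top: "g m \<in> topspace function_space" for m
    using g(1)[of m] path_components_of_subset by blast
  have "\<exists>m. g m \<in> P"
    using open_components[OF P(1)] P(2) g_top g(2) by (rule approximation_by_stages)
  then obtain m where "g m \<in> P" ..
  moreover obtain Q where "Q \<in> ?\<Pi>" "Q \<noteq> P" "g m \<in> Q" using g(1) by blast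
  ultimately show False
    using P(1) pairwise_disjoint_path_components_of by (metis disjnt_iff pairwiseD)
qed

end

theorem proposition2p3p6:
  fixes n :: nat
    and X :: "'a topology" and E :: "'a set set" and A :: "nat \<Rightarrow> 'a set"
    and Y :: "'b topology" and B :: "nat \<Rightarrow> 'b set"
    and Z :: "'c topology" and EZ :: "'c set set" and C :: "nat \<Rightarrow> 'c set"
    and W :: "'d topology" and EW :: "'d set set"
  assumes "CW_n_ad n X E A" and "countable E"
    and "n_ad n Y B"
    and "CW_n_ad n Z EZ C" and "n_ad_homotopy_equivalent n Y B Z C"
    and "n_ad_finite_homotopy_groups n Y B"
    and "CW_complex W EW" and "n_ad_function_space n X A Y B homotopy_equivalent_space W"
  shows "finite (path_components_of (n_ad_function_space n X A Y B))"
proof -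
  obtain d \<phi> where "cell_structure X E d \<phi>"
    using assms(1) cell_structure_of_CW_complex unfolding CW_n_ad_def by blast
  then interpret n_ad_cell_structure X E d \<phi> n A Y B
    using assms(1) by (simp add: n_ad_cell_structure_def n_ad_cell_structure_axioms_def CW_n_ad_def)
  obtain K where "K 0 = {}" "\<And>m. finite_subcomplex (K m)" "\<And>m. K m \<subseteq> K (Suc m)" "(\<Union>m. K m) = E"
    using exhaustion_by_finite_subcomplexes[OF assms(2)] by blast
  then interpret exhausted_n_ad X E d \<phi> n A Y B K
    by unfold_locales
  obtain d' \<phi>' where "cell_structure W EW d' \<phi>'"
    using assms(7) cell_structure_of_CW_complex by blast
  then have "openin W Q" if "Q \<in> path_components_of W" for Q
    using that by (rule cell_structure.openin_path_component)
  then show ?thesis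
    using openin_path_component_homotopy_equivalent[OF assms(8)] finite_path_components[OF assms(6)] by blast
qed

end
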